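(* Let $(T(t))_{t\ge 0}$ be a bounded $C_0$-semigroup on a Hilbert space $X$, with generator $-A$. Assume that $\sigma(A)\cap i\mathbb{R}$ is empty, and that $$\|(is+A)^{-1}\|=O\left(\frac{|s|^{\alpha}}{\ell(|s|)}\right),\qquad |s|\to\infty,$$ where $\alpha>0$ and $\ell$ is increasing and slowly varying. Then $$\|T(t)A^{-1}\|=O\left(\big(t\,\ell(t^{1/\alpha})\big)^{-1/\alpha}\right),\qquad t\to\infty.$$
   Context: A strictly positive measurable function $\ell$ on $[a,\infty)$ (for some $a$) is slowly varying if $\lim_{s\to\infty}\ell(\lambda s)/\ell(s)=1$ for every $\lambda>0$. "Increasing" means non-decreasing. The generator of the semigroup is $-A$; in the resolvent estimate $s$ is real. *)

theory Defs
  imports "HOL-Analysis.Analysis" "HOL-Library.Landau_Symbols"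
begin

text \<open>
  A complex inner product space is taken together with its underlying real inner product
  space, so that the norm, the topology and completeness are the library's. The positive
  definiteness of \<open>cinner\<close>, the identity \<open>norm x = sqrt (Re (cinner x x))\<close> and
  \<open>scaleC 1 x = x\<close> follow from the axioms of \<open>real_inner\<close> through the two compatibility
  axioms \<open>scaleR_scaleC\<close> and \<open>inner_eq_Re_cinner\<close>.
\<close>

class complex_inner = real_inner +
  fixes scaleC :: "complex \<Rightarrow> 'a \<Rightarrow> 'a"  (infixr \<open>*\<^sub>C\<close> 75)
    and cinner :: "'a \<Rightarrow> 'a \<Rightarrow> complex"
  assumes scaleC_add_right: "c *\<^sub>C (x + y) = c *\<^sub>C x + c *\<^sub>C y"
    and scaleC_add_left: "(c + d) *\<^sub>C x = c *\<^sub>C x + d *\<^sub>C x"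
    and scaleC_scaleC: "c *\<^sub>C (d *\<^sub>C x) = (c * d) *\<^sub>C x"
    and scaleR_scaleC: "r *\<^sub>R x = complex_of_real r *\<^sub>C x"
    and cinner_commute: "cinner x y = cnj (cinner y x)"
    and cinner_add_left: "cinner (x + y) z = cinner x z + cinner y z"
    and cinner_scaleC_left: "cinner (c *\<^sub>C x) y = c * cinner x y"
    and inner_eq_Re_cinner: "inner x y = Re (cinner x y)"

class complex_hilbert = complex_inner + complete_space

subclass (in complex_hilbert) banach ..

instantiation complex :: complex_hilbert
begin

definition scaleC_complex :: "complex \<Rightarrow> complex \<Rightarrow> complex"
  where "scaleC_complex c x = c * x"

definition cinner_complex :: "complex \<Rightarrow> complex \<Rightarrow> complex"
  where "cinner_complex x y = x * cnj y"

instance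
  by standard
    (auto simp: scaleC_complex_def cinner_complex_def inner_complex_def algebra_simps
      scaleR_conv_of_real)

end

definition bounded_clinear :: "('a::complex_inner \<Rightarrow> 'a) \<Rightarrow> bool"
  where "bounded_clinear f \<longleftrightarrow> bounded_linear f \<and> (\<forall>c x. f (c *\<^sub>C x) = c *\<^sub>C f x)"

text \<open>The values of a semigroup at negative times are irrelevant throughout.\<close>

definition C0_semigroup :: "(real \<Rightarrow> 'a::complex_inner \<Rightarrow> 'a) \<Rightarrow> bool"
  where "C0_semigroup T \<longleftrightarrow>
    (\<forall>t\<ge>0. bounded_clinear (T t)) \<and>
    (\<forall>x. T 0 x = x) \<and>
    (\<forall>s\<ge>0. \<forall>t\<ge>0. \<forall>x. T (s + t) x = T s (T t x)) \<and>
    (\<forall>x. ((\<lambda>t. T t x) \<longlongrightarrow> x) (at_right 0))"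

definition bounded_semigroup :: "(real \<Rightarrow> 'a::complex_inner \<Rightarrow> 'a) \<Rightarrow> bool"
  where "bounded_semigroup T \<longleftrightarrow> (\<exists>M. \<forall>t\<ge>0. onorm (T t) \<le> M)"

text \<open>
  An unbounded operator is given by its domain \<open>D\<close> and a total function of which only the
  values on \<open>D\<close> matter.
\<close>

definition is_generator ::
    "(real \<Rightarrow> 'a::complex_inner \<Rightarrow> 'a) \<Rightarrow> 'a set \<Rightarrow> ('a \<Rightarrow> 'a) \<Rightarrow> bool"
  where "is_generator T D B \<longleftrightarrow>
    D = {x. \<exists>y. ((\<lambda>h. (1 / h) *\<^sub>R (T h x - x)) \<longlongrightarrow> y) (at_right 0)} \<and>
    (\<forall>x\<in>D. ((\<lambda>h. (1 / h) *\<^sub>R (T h x - x)) \<longlongrightarrow> B x) (at_right 0))"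

definition resolvent_set :: "'a::complex_inner set \<Rightarrow> ('a \<Rightarrow> 'a) \<Rightarrow> complex set"
  where "resolvent_set D A =
    {z. bij_betw (\<lambda>x. z *\<^sub>C x - A x) D UNIV \<and>
        bounded_clinear (inv_into D (\<lambda>x. z *\<^sub>C x - A x))}"

definition op_spectrum :: "'a::complex_inner set \<Rightarrow> ('a \<Rightarrow> 'a) \<Rightarrow> complex set"
  where "op_spectrum D A = - resolvent_set D A"

definition slowly_varying_on :: "real \<Rightarrow> (real \<Rightarrow> real) \<Rightarrow> bool"
  where "slowly_varying_on a l \<longleftrightarrow>
    (\<forall>s\<ge>a. l s > 0) \<and>
    l \<in> borel_measurable (lebesgue_on {a..}) \<and>
    (\<forall>c>0. ((\<lambda>s. l (c * s) / l s) \<longlongrightarrow> 1) at_top)"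

end

theory Submission
  imports Defs
begin

text \<open>
  The proof works in the time domain on one interval \<open>{0..t}\<close> and uses the Hilbert space through
  Fourier series only. Write \<open>R s = (\<i> s + A)\<inverse>\<close> (below: \<open>res s\<close>, so that \<open>R 0 = A\<inverse>\<close>), let
  \<open>\<phi> u = (u (1 - u))\<^sup>n\<close> and consider the windowed orbit \<open>f u = \<phi> u T(t u) A\<inverse> x\<close> on the unit interval.

  Because \<open>\<phi>\<close> vanishes to order \<open>n\<close> at both ends, \<open>n\<close> integrations by parts express the Fourier
  coefficients of \<open>f\<close> through those of the bounded function \<open>g u = \<phi>\<^sup>(\<^sup>n\<^sup>) u T(t u) x\<close>: the \<open>k\<close>-th one is
  \<open>t\<^sup>-\<^sup>n R(s)\<^sup>n A\<inverse>\<close> applied to that of \<open>g\<close>, with \<open>s = 2 \<pi> k / t\<close> (\<open>fcoeff_windowed_orbit_res_0\<close>). By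
  Bessel's inequality the frequencies \<open>\<bar>s\<bar> \<le> r\<close> contribute at most a multiple of \<open>G / t\<^sup>n\<close> to the root
  mean square of \<open>f\<close>, where \<open>G\<close> bounds \<open>R(s)\<^sup>n A\<inverse>\<close> for \<open>\<bar>s\<bar> \<le> r\<close>. The orbit of \<open>A\<inverse> x\<close> is Lipschitz, so by
  Jackson's theorem the frequencies above \<open>r\<close> contribute at most a multiple of \<open>1 / r\<close>
  (\<open>integral_norm2_le_low_frequencies\<close>). As \<open>T\<close> is bounded, the norm of \<open>T(t) A\<inverse> x\<close> is at most a multiple
  of the root mean square of \<open>f\<close>, whence \<open>orbit_decay\<close>:
  \<open>\<parallel>T(t) A\<inverse>\<parallel> \<le> C (1 / r + G / t\<^sup>n)\<close>.

  With \<open>M s = s\<^sup>\<alpha> / l s\<close>, the resolvent identity gives one factor \<open>R(s) A\<inverse> = (A\<inverse> - R(s)) / (\<i> s)\<close>, of order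
  \<open>M s / s\<close>, and so \<open>R(s)\<^sup>n A\<inverse>\<close> has order \<open>(M s)\<^sup>n / s\<close>. If \<open>n \<alpha> \<ge> 2\<close>, Potter's bound shows that this
  quotient increases up to a constant factor; hence \<open>G\<close> can be taken as a multiple of
  \<open>(M r)\<^sup>n / r\<close> (\<open>norm_res_power_res_0_le\<close>), and the bound on the semigroup becomes
  \<open>C (1 + (M r / t)\<^sup>n) / r\<close>. For \<open>r = (t l(t\<^sup>1\<^sup>/\<^sup>\<alpha>))\<^sup>1\<^sup>/\<^sup>\<alpha>\<close> slow variation yields \<open>M r \<le> 2 t\<close>
  (\<open>eventually_decay_frequency\<close>), which leaves the asserted \<open>O(1 / r)\<close>.
\<close>

section \<open>Complex inner product spaces\<close>

lemma scaleC_0_left [simp]: "0 *\<^sub>C (x::'a::complex_inner) = 0"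
  using scaleC_add_left[of 0 0 x] by simp

lemma scaleC_0_right [simp]: "c *\<^sub>C (0::'a::complex_inner) = 0"
  using scaleC_add_right[of c 0 "0::'a"] by simp

lemma scaleC_1 [simp]: "1 *\<^sub>C (x::'a::complex_inner) = x"
  using scaleR_scaleC[of 1 x] by simp

lemma scaleC_minus_left: "(- c) *\<^sub>C (x::'a::complex_inner) = - (c *\<^sub>C x)"
  using scaleC_add_left[of c "- c" x] by (simp add: eq_neg_iff_add_eq_0 add.commute)

lemma scaleC_minus_right: "c *\<^sub>C (- (x::'a::complex_inner)) = - (c *\<^sub>C x)"
  using scaleC_add_right[of c x "- x"] by (simp add: eq_neg_iff_add_eq_0 add.commute)

lemma scaleC_diff_left: "(c - d) *\<^sub>C (x::'a::complex_inner) = c *\<^sub>C x - d *\<^sub>C x"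
  using scaleC_add_left[of c "- d" x] by (simp add: scaleC_minus_left)

lemma scaleC_diff_right: "c *\<^sub>C ((x::'a::complex_inner) - y) = c *\<^sub>C x - c *\<^sub>C y"
  using scaleC_add_right[of c x "- y"] by (simp add: scaleC_minus_right)

lemma scaleC_scaleR: "c *\<^sub>C (r *\<^sub>R (x::'a::complex_inner)) = r *\<^sub>R (c *\<^sub>C x)"
  by (simp add: scaleR_scaleC scaleC_scaleC mult.commute)

lemma scaleR_scaleC_left: "(r *\<^sub>R c) *\<^sub>C (x::'a::complex_inner) = r *\<^sub>R (c *\<^sub>C x)"
  by (simp add: scaleR_conv_of_real scaleR_scaleC[of r "c *\<^sub>C x"] scaleC_scaleC)

lemma inner_scaleC_left: "inner (c *\<^sub>C (x::'a::complex_inner)) y = inner x (cnj c *\<^sub>C y)"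
proof -
  have "cinner x (cnj c *\<^sub>C y) = cnj (cinner (cnj c *\<^sub>C y) x)"
    by (rule cinner_commute)
  also have "\<dots> = c * cinner x y"
    using cinner_commute[of x y] by (simp add: cinner_scaleC_left)
  finally show ?thesis
    by (simp add: inner_eq_Re_cinner cinner_scaleC_left)
qed

lemma norm_scaleC [simp]: "norm (c *\<^sub>C (x::'a::complex_inner)) = cmod c * norm x"
proof -
  have "inner (c *\<^sub>C x) (c *\<^sub>C x) = inner x ((cnj c * c) *\<^sub>C x)"
    by (simp add: inner_scaleC_left scaleC_scaleC)
  also have "\<dots> = inner x (((cmod c)\<^sup>2) *\<^sub>R x)"
    by (simp add: scaleR_scaleC complex_norm_square mult.commute del: of_real_power)
  finally have "(norm (c *\<^sub>C x))\<^sup>2 = (cmod c * norm x)\<^sup>2"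
    by (simp add: power2_norm_eq_inner power_mult_distrib)
  then show ?thesis
    by (simp add: power2_eq_iff_nonneg)
qed

lemma bounded_bilinear_scaleC: "bounded_bilinear ((*\<^sub>C) :: complex \<Rightarrow> 'a::complex_inner \<Rightarrow> 'a)"
  by (intro bounded_bilinear.intro exI[of _ 1])
    (auto simp: scaleC_add_left scaleC_add_right scaleC_scaleR scaleR_scaleC_left)

lemmas bounded_linear_scaleC_right = bounded_bilinear.bounded_linear_right[OF bounded_bilinear_scaleC]
lemmas bounded_linear_scaleC_left = bounded_bilinear.bounded_linear_left[OF bounded_bilinear_scaleC]
lemmas continuous_on_scaleC [continuous_intros] =
  bounded_bilinear.continuous_on[OF bounded_bilinear_scaleC]

section \<open>Trigonometric polynomials with Hilbert space coefficients\<close>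

definition fmode :: "int \<Rightarrow> real \<Rightarrow> complex"
  where "fmode k s = cis (2 * pi * of_int k * s)"

definition fcoeff :: "(real \<Rightarrow> 'a::complex_hilbert) \<Rightarrow> int \<Rightarrow> 'a"
  where "fcoeff f k = integral {0..1} (\<lambda>s. fmode (- k) s *\<^sub>C f s)"

lemma fmode_0 [simp]: "fmode 0 s = 1"
  by (simp add: fmode_def)

lemma norm_fmode [simp]: "cmod (fmode k s) = 1"
  by (simp add: fmode_def)

lemma cnj_fmode: "cnj (fmode k s) = fmode (- k) s"
  by (simp add: fmode_def cis_cnj)

lemma fmode_mult: "fmode j s * fmode k s = fmode (j + k) s"
  by (simp add: fmode_def cis_mult algebra_simps)

lemma fmode_diff: "fmode k (r - s) = fmode k r * fmode (- k) s"
  by (simp add: fmode_def cis_mult algebra_simps)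

lemma fmode_at_1 [simp]: "fmode k 1 = 1"
  by (simp add: fmode_def)

lemma fmode_at_0 [simp]: "fmode k 0 = 1"
  by (simp add: fmode_def)

lemma continuous_on_fmode [continuous_intros]:
  "continuous_on S g \<Longrightarrow> continuous_on S (\<lambda>x. fmode k (g x))"
  unfolding fmode_def by (intro continuous_intros)

lemma has_vector_derivative_fmode:
  "(fmode k has_vector_derivative (2 * pi * of_int k) *\<^sub>R (\<i> * fmode k s)) (at s within S)"
  unfolding fmode_def has_vector_derivative_def
  by (auto intro!: derivative_eq_intros simp: algebra_simps)

lemma has_integral_fmode: "(fmode k has_integral (if k = 0 then 1 else 0)) {0..1}"
proof (cases "k = 0")
  case True
  have "((\<lambda>s. 1 :: complex) has_integral 1) {0..1::real}"
    using has_integral_const_real[of "1::complex" 0 1] by simp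
  then show ?thesis
    using True by (simp add: fmode_def[abs_def])
next
  case False
  let ?c = "\<i> * (2 * pi * of_int k) :: complex"
  have "((\<lambda>s. fmode k s / ?c) has_vector_derivative fmode k s) (at s within {0..1})" for s
  proof -
    have "((\<lambda>s. fmode k s / ?c) has_vector_derivative
           ((2 * pi * of_int k) *\<^sub>R (\<i> * fmode k s)) / ?c) (at s within {0..1})"
      by (intro has_vector_derivative_divide has_vector_derivative_fmode)
    then show ?thesis
      using False by (simp add: scaleR_conv_of_real)
  qed
  then have "(fmode k has_integral (fmode k 1 / ?c - fmode k 0 / ?c)) {0..1}"
    by (intro fundamental_theorem_of_calculus) auto
  then show ?thesis
    using False by simp
qed

lemma has_integral_inner_left:
  "(f has_integral I) S \<Longrightarrow> ((\<lambda>s. inner (f s) v) has_integral inner I v) S"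
  using has_integral_linear[OF _ bounded_linear_inner_left, of f I S v] by (simp add: o_def)

lemma has_integral_inner_fmode:
  fixes f :: "real \<Rightarrow> 'a::complex_hilbert"
  assumes "continuous_on {0..1} f"
  shows "((\<lambda>s. inner (f s) (fmode k s *\<^sub>C v)) has_integral inner (fcoeff f k) v) {0..1}"
proof -
  have "((\<lambda>s. fmode (- k) s *\<^sub>C f s) has_integral fcoeff f k) {0..1}"
    unfolding fcoeff_def
    by (intro integrable_integral integrable_continuous_real continuous_intros assms)
  from has_integral_inner_left[OF this, of v] show ?thesis
    by (simp add: inner_scaleC_left cnj_fmode)
qed

lemma fcoeff_fmode: "fcoeff (\<lambda>s. fmode k s *\<^sub>C v) j = (if j = k then v else 0)"
proof -
  have "((\<lambda>s. fmode (k - j) s *\<^sub>C v) has_integral (if k - j = 0 then 1 else 0) *\<^sub>C v) {0..1}"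
    using has_integral_linear[OF has_integral_fmode bounded_linear_scaleC_left[of v], of "k - j"]
    by (simp add: o_def)
  then show ?thesis
    by (auto simp: fcoeff_def scaleC_scaleC fmode_mult algebra_simps intro: integral_unique)
qed

lemma has_integral_inner_trig_poly:
  fixes f :: "real \<Rightarrow> 'a::complex_hilbert"
  assumes "continuous_on {0..1} f" and "finite K"
  shows "((\<lambda>s. inner (f s) (\<Sum>k\<in>K. fmode k s *\<^sub>C v k))
           has_integral (\<Sum>k\<in>K. inner (fcoeff f k) (v k))) {0..1}"
  unfolding inner_sum_right
  by (intro has_integral_sum has_integral_inner_fmode assms)

lemma trig_poly_orthonormal:
  fixes v :: "int \<Rightarrow> 'a::complex_hilbert"
  assumes K: "finite K"
  shows "((\<lambda>s. (norm (\<Sum>k\<in>K. fmode k s *\<^sub>C v k))\<^sup>2) has_integral (\<Sum>k\<in>K. (norm (v k))\<^sup>2)) {0..1}"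
proof -
  have "((\<lambda>s. inner (fmode j s *\<^sub>C v j) (\<Sum>k\<in>K. fmode k s *\<^sub>C v k))
         has_integral (norm (v j))\<^sup>2) {0..1}" if "j \<in> K" for j
  proof -
    have "((\<lambda>s. inner (fmode j s *\<^sub>C v j) (\<Sum>k\<in>K. fmode k s *\<^sub>C v k))
         has_integral (\<Sum>k\<in>K. inner (fcoeff (\<lambda>s. fmode j s *\<^sub>C v j) k) (v k))) {0..1}"
      by (intro has_integral_inner_trig_poly continuous_intros K)
    also have "(\<Sum>k\<in>K. inner (fcoeff (\<lambda>s. fmode j s *\<^sub>C v j) k) (v k))
        = (\<Sum>k\<in>K. if k = j then inner (v j) (v j) else 0)"
      by (intro sum.cong) (auto simp: fcoeff_fmode)
    also have "\<dots> = (norm (v j))\<^sup>2"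
      using K that by (simp add: power2_norm_eq_inner)
    finally show ?thesis .
  qed
  from has_integral_sum[OF K this] show ?thesis
    by (simp add: power2_norm_eq_inner inner_sum_left)
qed

text \<open>
  This one identity yields Bessel's inequality, for the coefficients \<open>v = fcoeff f\<close>, and the
  fact that the Fourier partial sum is the best mean square approximation.
\<close>

lemma has_integral_trig_poly_error:
  fixes f :: "real \<Rightarrow> 'a::complex_hilbert"
  assumes f: "continuous_on {0..1} f" and K: "finite K"
  shows "((\<lambda>s. (norm (f s - (\<Sum>k\<in>K. fmode k s *\<^sub>C v k)))\<^sup>2) has_integral
           (integral {0..1} (\<lambda>s. (norm (f s))\<^sup>2) - (\<Sum>k\<in>K. (norm (fcoeff f k))\<^sup>2)
             + (\<Sum>k\<in>K. (norm (fcoeff f k - v k))\<^sup>2))) {0..1}"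
proof -
  let ?p = "\<lambda>s. \<Sum>k\<in>K. fmode k s *\<^sub>C v k"
  have "((\<lambda>s. (norm (f s))\<^sup>2) has_integral integral {0..1} (\<lambda>s. (norm (f s))\<^sup>2)) {0..1}"
    by (intro integrable_integral integrable_continuous_real continuous_intros f)
  note I = has_integral_add[OF has_integral_diff[OF this
        has_integral_mult_right[OF has_integral_inner_trig_poly[OF f K, of v], of 2]]
      trig_poly_orthonormal[OF K, of v]]
  have "(\<lambda>s. (norm (f s))\<^sup>2 - 2 * inner (f s) (?p s) + (norm (?p s))\<^sup>2)
      = (\<lambda>s. (norm (f s - ?p s))\<^sup>2)"
    by (simp add: power2_norm_eq_inner inner_diff_left inner_diff_right inner_commute fun_eq_iff)
  moreover
  have "(\<Sum>k\<in>K. (norm (fcoeff f k - v k))\<^sup>2)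
      = (\<Sum>k\<in>K. (norm (fcoeff f k))\<^sup>2) - 2 * (\<Sum>k\<in>K. inner (fcoeff f k) (v k))
        + (\<Sum>k\<in>K. (norm (v k))\<^sup>2)"
    by (simp add: power2_norm_eq_inner inner_diff_left inner_diff_right inner_commute
        sum.distrib sum_subtractf sum_distrib_left)
  then have "integral {0..1} (\<lambda>s. (norm (f s))\<^sup>2) - 2 * (\<Sum>k\<in>K. inner (fcoeff f k) (v k))
        + (\<Sum>k\<in>K. (norm (v k))\<^sup>2)
      = integral {0..1} (\<lambda>s. (norm (f s))\<^sup>2) - (\<Sum>k\<in>K. (norm (fcoeff f k))\<^sup>2)
        + (\<Sum>k\<in>K. (norm (fcoeff f k - v k))\<^sup>2)"
    by linarith
  ultimately show ?thesis
    using I by (simp only:)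
qed

lemma bessel_inequality:
  fixes f :: "real \<Rightarrow> 'a::complex_hilbert"
  assumes "continuous_on {0..1} f" and "finite K"
  shows "(\<Sum>k\<in>K. (norm (fcoeff f k))\<^sup>2) \<le> integral {0..1} (\<lambda>s. (norm (f s))\<^sup>2)"
  using has_integral_nonneg[OF has_integral_trig_poly_error[OF assms, of "fcoeff f"]] by simp

text \<open>
  The polynomial enters through its distance to \<open>f\<close> alone: replacing its coefficients by those of
  \<open>f\<close> only decreases the mean square error.
\<close>

lemma integral_norm2_le_coeffs_plus_error:
  fixes f :: "real \<Rightarrow> 'a::complex_hilbert"
  assumes f: "continuous_on {0..1} f" and K: "finite K"
    and err: "\<And>s. s \<in> {0..1} \<Longrightarrow> norm (f s - (\<Sum>k\<in>K. fmode k s *\<^sub>C v k)) \<le> E"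
  shows "integral {0..1} (\<lambda>s. (norm (f s))\<^sup>2) \<le> (\<Sum>k\<in>K. (norm (fcoeff f k))\<^sup>2) + E\<^sup>2"
proof -
  note I = has_integral_trig_poly_error[OF f K, of v]
  have "((\<lambda>s. E\<^sup>2) has_integral E\<^sup>2) {0..1::real}"
    using has_integral_const_real[of "E\<^sup>2" 0 1] by simp
  from has_integral_le[OF I this power_mono[OF err norm_ge_zero]]
  have "integral {0..1} (\<lambda>s. (norm (f s))\<^sup>2) - (\<Sum>k\<in>K. (norm (fcoeff f k))\<^sup>2)
         + (\<Sum>k\<in>K. (norm (fcoeff f k - v k))\<^sup>2) \<le> E\<^sup>2"
    by simp
  moreover have "0 \<le> (\<Sum>k\<in>K. (norm (fcoeff f k - v k))\<^sup>2)"
    by (simp add: sum_nonneg)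
  ultimately show ?thesis
    by linarith
qed

section \<open>Approximation of Lipschitz functions\<close>

text \<open>
  \<open>jackson_poly m\<close> has degree \<open>2 * m\<close> and triangular coefficients. Its squared modulus,
  divided by \<open>jackson_mass m\<close>, is Jackson's kernel: it has integral 1 and is
  concentrated at distance of order \<open>1 / m\<close> from the integers, because consecutive
  coefficients differ by at most 1 whereas their squares add up to order \<open>m ^ 3\<close>.
\<close>

definition jackson_coeff :: "nat \<Rightarrow> int \<Rightarrow> real"
  where "jackson_coeff m j = of_int (max 0 (min j (2 * int m - j)))"

definition jackson_poly :: "nat \<Rightarrow> real \<Rightarrow> complex"
  where "jackson_poly m u = (\<Sum>j\<in>{0..2 * int m}. fmode j u *\<^sub>C complex_of_real (jackson_coeff m j))"

definition jackson_mass :: "nat \<Rightarrow> real"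
  where "jackson_mass m = (\<Sum>j\<in>{0..2 * int m}. (jackson_coeff m j)\<^sup>2)"

lemma jackson_mass_ge: "real m ^ 3 / 3 \<le> jackson_mass m"
proof -
  have *: "real m ^ 3 / 3 \<le> (\<Sum>j\<le>m. (real j)\<^sup>2)" for m :: nat
    by (induction m) (auto simp: field_simps power2_eq_square power3_eq_cube)
  have "(\<Sum>j\<le>m. (real j)\<^sup>2) = (\<Sum>j\<in>int ` {..m}. (jackson_coeff m j)\<^sup>2)"
    by (subst sum.reindex) (auto simp: jackson_coeff_def)
  also have "\<dots> \<le> jackson_mass m"
    unfolding jackson_mass_def by (intro sum_mono2) auto
  finally show ?thesis
    using *[of m] by linarith
qed

lemma jackson_poly_shift_integral:
  "((\<lambda>r. (cmod (jackson_poly m (r - s)))\<^sup>2) has_integral jackson_mass m) {0..1}"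
proof -
  have eq: "jackson_poly m (r - s) = (\<Sum>j\<in>{0..2 * int m}.
      fmode j r *\<^sub>C (fmode (- j) s * complex_of_real (jackson_coeff m j)))" for r
    by (simp add: jackson_poly_def fmode_diff scaleC_complex_def mult.assoc)
  show ?thesis
    unfolding eq jackson_mass_def
    using trig_poly_orthonormal[of "{0..2 * int m}"
        "\<lambda>j. fmode (- j) s * complex_of_real (jackson_coeff m j)"]
    by (simp add: norm_mult)
qed

lemma jackson_poly_first_difference:
  "jackson_poly m u * (1 - fmode 1 u) =
     (\<Sum>j\<in>{0..2 * int m + 1}. fmode j u * complex_of_real (jackson_coeff m j - jackson_coeff m (j - 1)))"
proof -
  let ?a = "jackson_coeff m"
  have "jackson_poly m u = (\<Sum>j\<in>{0..2 * int m + 1}. fmode j u * complex_of_real (?a j))"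
    unfolding jackson_poly_def scaleC_complex_def
    by (intro sum.mono_neutral_left) (auto simp: jackson_coeff_def)
  moreover have "jackson_poly m u * fmode 1 u
      = (\<Sum>j\<in>{1..2 * int m + 1}. fmode j u * complex_of_real (?a (j - 1)))"
    unfolding jackson_poly_def scaleC_complex_def sum_distrib_right
    by (rule sum.reindex_bij_witness[of _ "\<lambda>j. j - 1" "\<lambda>j. j + 1"])
      (auto simp: fmode_mult[symmetric] mult_ac)
  moreover have "\<dots> = (\<Sum>j\<in>{0..2 * int m + 1}. fmode j u * complex_of_real (?a (j - 1)))"
    by (intro sum.mono_neutral_left) (auto simp: jackson_coeff_def)
  ultimately show ?thesis
    by (simp add: right_diff_distrib sum_subtractf)
qed

text \<open>
  Multiplication by \<open>1 - fmode 1\<close> differences the coefficients, so this integral is a sum of about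
  \<open>2 * m\<close> squares of differences, each at most 1. The factor \<open>1 - fmode 1 u\<close> measures the distance of
  \<open>u\<close> from the integers.
\<close>

lemma jackson_poly_second_moment:
  obtains I where "((\<lambda>r. (cmod (jackson_poly m (r - s) * (1 - fmode 1 (r - s))))\<^sup>2) has_integral I) {0..1}"
    and "I \<le> 2 * real m + 2"
proof
  let ?d = "\<lambda>j. jackson_coeff m j - jackson_coeff m (j - 1)"
  have eq: "jackson_poly m (r - s) * (1 - fmode 1 (r - s)) =
     (\<Sum>j\<in>{0..2 * int m + 1}. fmode j r *\<^sub>C (fmode (- j) s * complex_of_real (?d j)))" for r
    unfolding jackson_poly_first_difference
    by (simp add: fmode_diff scaleC_complex_def mult.assoc)
  show "((\<lambda>r. (cmod (jackson_poly m (r - s) * (1 - fmode 1 (r - s))))\<^sup>2) has_integral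
      (\<Sum>j\<in>{0..2 * int m + 1}. (cmod (fmode (- j) s * complex_of_real (?d j)))\<^sup>2)) {0..1}"
    unfolding eq by (intro trig_poly_orthonormal) simp
  have "\<bar>?d j\<bar> \<le> 1" for j
    by (auto simp: jackson_coeff_def max_def min_def)
  then have "(\<Sum>j\<in>{0..2 * int m + 1}. (cmod (fmode (- j) s * complex_of_real (?d j)))\<^sup>2)
      \<le> (\<Sum>j\<in>{0..2 * int m + 1}. 1)"
    by (intro sum_mono) (simp add: norm_mult abs_square_le_1 flip: of_real_diff)
  then show "(\<Sum>j\<in>{0..2 * int m + 1}. (cmod (fmode (- j) s * complex_of_real (?d j)))\<^sup>2)
      \<le> 2 * real m + 2"
    by simp
qed

lemma sin_pi_ge:
  assumes "0 \<le> d" "d \<le> 1 / 2"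
  shows "2 * d \<le> sin (pi * d)"
proof -
  have "convex_on {0..pi} (\<lambda>x. - sin x)"
    by (rule f''_ge0_imp_convex[of _ _ "\<lambda>x. - cos x" sin])
      (auto intro!: derivative_eq_intros simp: sin_ge_zero)
  from convex_onD[OF this, of "2 * d" 0 "pi / 2"] assms show ?thesis
    by (simp add: mult.commute)
qed

lemma circle_distance_le_fmode:
  assumes "0 \<le> d" "d \<le> 1"
  shows "4 * min d (1 - d) \<le> cmod (1 - fmode 1 d)"
proof -
  have "cmod (1 - fmode 1 d) = 2 * \<bar>sin (pi * d)\<bar>"
    using dist_exp_i_1[of "2 * pi * d"]
    by (simp add: fmode_def cis_conv_exp norm_minus_commute mult_ac)
  moreover have "2 * min d (1 - d) \<le> sin (pi * d)"
  proof (cases "d \<le> 1 / 2")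
    case True
    then show ?thesis using sin_pi_ge[of d] assms by simp
  next
    case False
    then have "2 * (1 - d) \<le> sin (pi - pi * d)"
      using sin_pi_ge[of "1 - d"] assms by (simp add: algebra_simps)
    then have "2 * (1 - d) \<le> sin (pi * d)" by simp
    then show ?thesis by (simp add: min_def)
  qed
  ultimately show ?thesis by linarith
qed

text \<open>
  Since \<open>f 0 = f 1\<close>, the way from \<open>s\<close> to \<open>r\<close> may also lead through the end points, so the Lipschitz bound
  holds for the distance on the circle.
\<close>

lemma periodic_lipschitz_le_fmode:
  fixes f :: "real \<Rightarrow> 'a::real_normed_vector"
  assumes lip: "\<And>r s. r \<in> {0..1} \<Longrightarrow> s \<in> {0..1} \<Longrightarrow> norm (f r - f s) \<le> L * \<bar>r - s\<bar>"
    and per: "f 0 = f 1" and rs: "r \<in> {0..1}" "s \<in> {0..1}"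
  shows "4 * norm (f r - f s) \<le> L * cmod (1 - fmode 1 (r - s))"
proof -
  have L: "0 \<le> L" using order_trans[OF norm_ge_zero lip[of 0 1]] by simp
  have *: "4 * norm (f r - f s) \<le> L * cmod (1 - fmode 1 (r - s))"
    if "r \<in> {0..1}" "s \<in> {0..1}" "s \<le> r" for r s
  proof -
    have "f r - f s = (f r - f 1) + (f 0 - f s)"
      using per by simp
    then have "norm (f r - f s) \<le> norm (f r - f 1) + norm (f 0 - f s)"
      by (metis norm_triangle_ineq)
    also have "\<dots> \<le> L * (1 - (r - s))"
      using lip[of r 1] lip[of 0 s] that by (simp add: algebra_simps)
    finally have "norm (f r - f s) \<le> L * min (r - s) (1 - (r - s))"
      using lip[of r s] that by (simp add: min_def)
    also have "\<dots> \<le> L * (cmod (1 - fmode 1 (r - s)) / 4)"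
      using circle_distance_le_fmode[of "r - s"] that L by (intro mult_left_mono) auto
    finally show ?thesis by simp
  qed
  show ?thesis
  proof (cases "s \<le> r")
    case True
    then show ?thesis using * rs by blast
  next
    case False
    have "1 - fmode 1 (s - r) = cnj (1 - fmode 1 (r - s))"
      by (simp add: cnj_fmode) (simp add: fmode_def algebra_simps)
    then have "cmod (1 - fmode 1 (s - r)) = cmod (1 - fmode 1 (r - s))"
      by (metis complex_mod_cnj)
    then show ?thesis using *[of s r] rs False by (simp add: norm_minus_commute)
  qed
qed

lemma trig_poly_regroup:
  fixes c :: "int \<Rightarrow> int \<Rightarrow> 'a::complex_hilbert"
  assumes "finite J" "finite K" "\<And>i j. i \<in> J \<Longrightarrow> j \<in> J \<Longrightarrow> j - i \<in> K"
  obtains v where "\<And>s. (\<Sum>i\<in>J. \<Sum>j\<in>J. fmode (j - i) s *\<^sub>C c i j) = (\<Sum>k\<in>K. fmode k s *\<^sub>C v k)"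
proof
  fix s
  let ?g = "\<lambda>(i, j). j - i :: int"
  have "(\<Sum>i\<in>J. \<Sum>j\<in>J. fmode (j - i) s *\<^sub>C c i j) = (\<Sum>p\<in>J \<times> J. fmode (?g p) s *\<^sub>C (case p of (i, j) \<Rightarrow> c i j))"
    by (simp add: sum.cartesian_product case_prod_unfold)
  also have "\<dots> = (\<Sum>k\<in>K. \<Sum>p\<in>{p \<in> J \<times> J. ?g p = k}. fmode (?g p) s *\<^sub>C (case p of (i, j) \<Rightarrow> c i j))"
    using assms by (intro sum.group[symmetric]) auto
  also have "\<dots> = (\<Sum>k\<in>K. \<Sum>p\<in>{p \<in> J \<times> J. ?g p = k}. fmode k s *\<^sub>C (case p of (i, j) \<Rightarrow> c i j))"
    by (intro sum.cong) auto
  also have "\<dots> = (\<Sum>k\<in>K. fmode k s *\<^sub>C (\<Sum>p\<in>{p \<in> J \<times> J. ?g p = k}. case p of (i, j) \<Rightarrow> c i j))"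
    using bounded_linear_scaleC_right
    by (intro sum.cong) (auto simp: linear_sum[OF bounded_linear.linear, OF bounded_linear_scaleC_right])
  finally show "(\<Sum>i\<in>J. \<Sum>j\<in>J. fmode (j - i) s *\<^sub>C c i j) =
    (\<Sum>k\<in>K. fmode k s *\<^sub>C (\<Sum>p\<in>{p \<in> J \<times> J. ?g p = k}. case p of (i, j) \<Rightarrow> c i j))" .
qed

text \<open>The convolution of \<open>f\<close> with Jackson's kernel, up to the factor \<open>jackson_mass m\<close>.\<close>

lemma jackson_convolution_trig_poly:
  fixes f :: "real \<Rightarrow> 'a::complex_hilbert"
  assumes f: "continuous_on {0..1} f"
  obtains v where "\<And>s. ((\<lambda>r. (cmod (jackson_poly m (r - s)))\<^sup>2 *\<^sub>R f r) has_integral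
       (\<Sum>k\<in>{- 2 * int m..2 * int m}. fmode k s *\<^sub>C v k)) {0..1}"
proof -
  let ?J = "{0..2 * int m}"
  let ?a = "jackson_coeff m"
  obtain v where v: "\<And>s. (\<Sum>i\<in>?J. \<Sum>j\<in>?J. fmode (j - i) s *\<^sub>C ((?a i * ?a j) *\<^sub>R fcoeff f (j - i)))
      = (\<Sum>k\<in>{- 2 * int m..2 * int m}. fmode k s *\<^sub>C v k)"
    by (rule trig_poly_regroup[of ?J "{- 2 * int m..2 * int m}"
          "\<lambda>i j. (?a i * ?a j) *\<^sub>R fcoeff f (j - i)"]) auto
  have "((\<lambda>r. (cmod (jackson_poly m (r - s)))\<^sup>2 *\<^sub>R f r) has_integral
       (\<Sum>k\<in>{- 2 * int m..2 * int m}. fmode k s *\<^sub>C v k)) {0..1}" for s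
  proof -
    have eq: "(cmod (jackson_poly m (r - s)))\<^sup>2 *\<^sub>R f r
        = (\<Sum>i\<in>?J. \<Sum>j\<in>?J. (?a i * ?a j) *\<^sub>R fmode (j - i) s *\<^sub>C fmode (i - j) r *\<^sub>C f r)" for r
    proof -
      have separate: "fmode i (r - s) * cnj (fmode j (r - s)) = fmode (j - i) s * fmode (i - j) r" for i j
        by (simp add: cnj_fmode fmode_mult) (simp add: fmode_def cis_mult algebra_simps)
      have "complex_of_real ((cmod (jackson_poly m (r - s)))\<^sup>2)
          = jackson_poly m (r - s) * cnj (jackson_poly m (r - s))"
        by (rule complex_norm_square)
      also have "\<dots> = (\<Sum>i\<in>?J. \<Sum>j\<in>?J. of_real (?a i * ?a j) * (fmode (j - i) s * fmode (i - j) r))"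
        unfolding jackson_poly_def cnj_sum sum_product
        by (simp add: scaleC_complex_def flip: separate) (simp add: mult_ac)
      finally have "complex_of_real ((cmod (jackson_poly m (r - s)))\<^sup>2) *\<^sub>C f r = (\<Sum>i\<in>?J. \<Sum>j\<in>?J.
         (of_real (?a i * ?a j) * (fmode (j - i) s * fmode (i - j) r)) *\<^sub>C f r)"
        by (simp add: linear_sum[OF bounded_linear.linear, OF bounded_linear_scaleC_left])
      then show ?thesis
        by (simp add: scaleR_scaleC scaleC_scaleC mult_ac)
    qed
    have summand: "((\<lambda>r. (?a i * ?a j) *\<^sub>R fmode (j - i) s *\<^sub>C fmode (i - j) r *\<^sub>C f r)
        has_integral (fmode (j - i) s *\<^sub>C ((?a i * ?a j) *\<^sub>R fcoeff f (j - i)))) {0..1}" for i j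
    proof -
      have "((\<lambda>r. fmode (i - j) r *\<^sub>C f r) has_integral fcoeff f (j - i)) {0..1}"
        unfolding fcoeff_def minus_diff_eq
        by (intro integrable_integral integrable_continuous_real continuous_intros f)
      from has_integral_cmul[OF has_integral_linear[OF this bounded_linear_scaleC_right[of "fmode (j - i) s"]],
          of "?a i * ?a j"]
      show ?thesis by (simp add: o_def scaleC_scaleR)
    qed
    show ?thesis
      unfolding eq v[symmetric] by (intro has_integral_sum summand) auto
  qed
  then show ?thesis using that by blast
qed

text \<open>
  Jackson's theorem for Lipschitz functions: averaging \<open>f\<close> against the kernel moves the values by
  at most \<open>L\<close> times the mean distance, which is estimated by the second moment through
  \<open>w \<le> (1 / m + m * w\<^sup>2) / 2\<close>.
\<close>

lemma jackson_approximation: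
  fixes f :: "real \<Rightarrow> 'a::complex_hilbert"
  assumes lip: "\<And>r s. r \<in> {0..1} \<Longrightarrow> s \<in> {0..1} \<Longrightarrow> norm (f r - f s) \<le> L * \<bar>r - s\<bar>"
    and per: "f 0 = f 1" and m: "m \<ge> 1"
  obtains v where "\<And>s. s \<in> {0..1} \<Longrightarrow>
    norm (f s - (\<Sum>k\<in>{- 2 * int m..2 * int m}. fmode k s *\<^sub>C v k)) \<le> 2 * L / m"
proof -
  have L: "0 \<le> L" using order_trans[OF norm_ge_zero lip[of 0 1]] by simp
  have f: "continuous_on {0..1} f"
    using lip L by (intro lipschitz_on_continuous_on[of L] lipschitz_onI) (auto simp: dist_norm)
  let ?N = "{- 2 * int m..2 * int m}"
  let ?S = "jackson_mass m"
  let ?k = "\<lambda>u. (cmod (jackson_poly m u))\<^sup>2"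
  let ?w = "\<lambda>u. cmod (1 - fmode 1 u)"
  have "0 < real m ^ 3 / 3" using m by simp
  then have S: "real m ^ 3 / 3 \<le> ?S" "0 < ?S"
    using jackson_mass_ge[of m] by linarith+
  obtain v where v: "\<And>s. ((\<lambda>r. ?k (r - s) *\<^sub>R f r) has_integral
       (\<Sum>k\<in>?N. fmode k s *\<^sub>C v k)) {0..1}"
    using jackson_convolution_trig_poly[OF f] by blast
  have main: "norm (?S *\<^sub>R f s - (\<Sum>k\<in>?N. fmode k s *\<^sub>C v k)) \<le> ?S * (2 * L / m)" if s: "s \<in> {0..1}" for s
  proof -
    obtain I where I: "((\<lambda>r. (cmod (jackson_poly m (r - s) * (1 - fmode 1 (r - s))))\<^sup>2) has_integral I) {0..1}"
      and Ile: "I \<le> 2 * real m + 2"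
      by (rule jackson_poly_second_moment)
    have d: "((\<lambda>r. ?k (r - s) *\<^sub>R (f s - f r)) has_integral
        (?S *\<^sub>R f s - (\<Sum>k\<in>?N. fmode k s *\<^sub>C v k))) {0..1}"
      using has_integral_diff[OF has_integral_linear[OF jackson_poly_shift_integral
            bounded_linear_scaleR_left[of "f s"]] v[of s]]
      by (simp add: o_def scaleR_diff_right)
    have b: "((\<lambda>r. L / 8 * (1 / m * ?k (r - s) + m * (cmod (jackson_poly m (r - s) * (1 - fmode 1 (r - s))))\<^sup>2))
        has_integral L / 8 * (1 / m * ?S + m * I)) {0..1}"
      by (intro has_integral_mult_right has_integral_add jackson_poly_shift_integral I)
    have le: "norm (?k (r - s) *\<^sub>R (f s - f r)) \<le>
        L / 8 * (1 / m * ?k (r - s) + m * (cmod (jackson_poly m (r - s) * (1 - fmode 1 (r - s))))\<^sup>2)"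
      if r: "r \<in> {0..1}" for r
    proof -
      have "0 \<le> (1 / m) * (1 - m * ?w (r - s))\<^sup>2" by simp
      then have w: "2 * ?w (r - s) \<le> 1 / m + m * (?w (r - s))\<^sup>2"
        using m by (simp add: power2_eq_square field_simps)
      have "4 * norm (f s - f r) \<le> L * ?w (r - s)"
        using periodic_lipschitz_le_fmode[OF lip per r s] by (simp add: norm_minus_commute)
      also have "\<dots> \<le> L * ((1 / m + m * (?w (r - s))\<^sup>2) / 2)"
        using w L by (intro mult_left_mono) auto
      finally have "norm (f s - f r) \<le> L / 8 * (1 / m + m * (?w (r - s))\<^sup>2)"
        by simp
      then have "?k (r - s) * norm (f s - f r) \<le> ?k (r - s) * (L / 8 * (1 / m + m * (?w (r - s))\<^sup>2))"
        by (intro mult_left_mono) auto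
      then show ?thesis
        unfolding norm_scaleR norm_mult power_mult_distrib by (simp add: field_simps)
    qed
    have "norm (?S *\<^sub>R f s - (\<Sum>k\<in>?N. fmode k s *\<^sub>C v k)) \<le> L / 8 * (1 / m * ?S + m * I)"
      using integral_norm_bound_integral[OF has_integral_integrable[OF d] has_integral_integrable[OF b] le]
      unfolding integral_unique[OF d] integral_unique[OF b] .
    also have "\<dots> \<le> L / 8 * (16 * (?S / m))"
    proof -
      have "m * I \<le> real m * (4 * real m)"
        using Ile m by (intro mult_left_mono) auto
      also have "\<dots> = 12 * ((real m ^ 3 / 3) / m)"
        using m by (simp add: power3_eq_cube)
      also have "\<dots> \<le> 12 * (?S / m)"
        using S m by (intro mult_left_mono divide_right_mono) auto
      finally have "1 / m * ?S + m * I \<le> 16 * (?S / m)"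
        using S m by (simp add: field_simps)
      then show ?thesis using L by (intro mult_left_mono) auto
    qed
    finally show ?thesis by (simp add: mult_ac)
  qed
  show ?thesis
  proof
    fix s :: real assume s: "s \<in> {0..1}"
    have "(\<Sum>k\<in>?N. fmode k s *\<^sub>C ((1 / ?S) *\<^sub>R v k)) = (1 / ?S) *\<^sub>R (\<Sum>k\<in>?N. fmode k s *\<^sub>C v k)"
      by (simp add: scaleC_scaleR scaleR_sum_right)
    then have "f s - (\<Sum>k\<in>?N. fmode k s *\<^sub>C ((1 / ?S) *\<^sub>R v k))
        = (1 / ?S) *\<^sub>R (?S *\<^sub>R f s - (\<Sum>k\<in>?N. fmode k s *\<^sub>C v k))"
      using S by (simp add: scaleR_diff_right)
    then have "norm (f s - (\<Sum>k\<in>?N. fmode k s *\<^sub>C ((1 / ?S) *\<^sub>R v k)))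
        = norm (?S *\<^sub>R f s - (\<Sum>k\<in>?N. fmode k s *\<^sub>C v k)) / ?S"
      using S by (simp only: norm_scaleR) simp
    also have "\<dots> \<le> 2 * L / m"
      using main[OF s] S by (simp add: divide_le_eq mult.commute)
    finally show "norm (f s - (\<Sum>k\<in>?N. fmode k s *\<^sub>C ((1 / ?S) *\<^sub>R v k))) \<le> 2 * L / m" .
  qed
qed

text \<open>
  A quantitative form of Parseval's identity: only finitely many Fourier coefficients
  have to be known, and the others are accounted for by the Lipschitz constant.
\<close>

lemma integral_norm2_le_low_frequencies:
  fixes f :: "real \<Rightarrow> 'a::complex_hilbert"
  assumes lip: "\<And>r s. r \<in> {0..1} \<Longrightarrow> s \<in> {0..1} \<Longrightarrow> norm (f r - f s) \<le> L * \<bar>r - s\<bar>"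
    and per: "f 0 = f 1" and m: "m \<ge> 1"
  shows "integral {0..1} (\<lambda>s. (norm (f s))\<^sup>2)
      \<le> (\<Sum>k\<in>{- 2 * int m..2 * int m}. (norm (fcoeff f k))\<^sup>2) + (2 * L / m)\<^sup>2"
proof -
  have "0 \<le> L" using order_trans[OF norm_ge_zero lip[of 0 1]] by simp
  then have f: "continuous_on {0..1} f"
    using lip by (intro lipschitz_on_continuous_on[of L] lipschitz_onI) (auto simp: dist_norm)
  obtain v where "\<And>s. s \<in> {0..1} \<Longrightarrow>
    norm (f s - (\<Sum>k\<in>{- 2 * int m..2 * int m}. fmode k s *\<^sub>C v k)) \<le> 2 * L / m"
    using jackson_approximation[OF lip per m] by blast
  then show ?thesis
    by (intro integral_norm2_le_coeffs_plus_error[OF f, of _ v]) auto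
qed

section \<open>Bounded semigroups whose generator has no imaginary spectrum\<close>

locale imaginary_resolvent_semigroup =
  fixes T :: "real \<Rightarrow> 'a::complex_hilbert \<Rightarrow> 'a"
    and D :: "'a set" and A :: "'a \<Rightarrow> 'a" and K :: real
  assumes C0: "C0_semigroup T"
    and generator: "is_generator T D (\<lambda>x. - A x)"
    and imaginary_resolvent: "op_spectrum D A \<inter> {z. Re z = 0} = {}"
    and K_ge_1: "1 \<le> K"
    and norm_T_le: "0 \<le> t \<Longrightarrow> norm (T t x) \<le> K * norm x"
begin

lemma T_bounded_clinear: "0 \<le> t \<Longrightarrow> bounded_clinear (T t)"
  using C0 by (simp add: C0_semigroup_def)

lemma T_bounded_linear: "0 \<le> t \<Longrightarrow> bounded_linear (T t)"
  using T_bounded_clinear by (simp add: bounded_clinear_def)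

lemma T_scaleC: "0 \<le> t \<Longrightarrow> T t (c *\<^sub>C x) = c *\<^sub>C T t x"
  using T_bounded_clinear by (simp add: bounded_clinear_def)

lemma T_0 [simp]: "T 0 x = x"
  using C0 by (simp add: C0_semigroup_def)

lemma T_add: "0 \<le> s \<Longrightarrow> 0 \<le> t \<Longrightarrow> T (s + t) x = T s (T t x)"
  using C0 by (simp add: C0_semigroup_def)

lemma T_tendsto_0: "((\<lambda>t. T t x) \<longlongrightarrow> x) (at_right 0)"
  using C0 by (simp add: C0_semigroup_def)

lemmas T_linear_simps = linear_add[OF bounded_linear.linear[OF T_bounded_linear]]
  linear_diff[OF bounded_linear.linear[OF T_bounded_linear]]
  linear_neg[OF bounded_linear.linear[OF T_bounded_linear]]
  linear_scale[OF bounded_linear.linear[OF T_bounded_linear]]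

lemma filterlim_abs_diff_at_right_0:
  "filterlim (\<lambda>s::real. \<bar>s - r\<bar>) (at_right 0) (at r within S)"
proof -
  have "((\<lambda>s. \<bar>s - r\<bar>) \<longlongrightarrow> \<bar>r - r\<bar>) (at r within S)"
    by (intro tendsto_intros)
  then show ?thesis
    by (auto simp: filterlim_at eventually_at_filter)
qed

lemma norm_T_diff_le:
  assumes "0 \<le> r" "0 \<le> s"
  shows "norm (T s x - T r x) \<le> K * norm (T \<bar>s - r\<bar> x - x)"
proof (cases "r \<le> s")
  case True
  then have "T s x - T r x = T r (T \<bar>s - r\<bar> x - x)"
    using assms T_add[of r "s - r" x] by (simp add: T_linear_simps)
  then show ?thesis using norm_T_le[OF assms(1)] by metis
next
  case False
  then have "T r x - T s x = T s (T \<bar>s - r\<bar> x - x)"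
    using assms T_add[of s "r - s" x] by (simp add: T_linear_simps)
  then show ?thesis using norm_T_le[OF assms(2)] by (metis norm_minus_commute)
qed

lemma continuous_on_orbit: "continuous_on {0..} (\<lambda>t. T t x)"
  unfolding continuous_on_def
proof
  fix r :: real assume r: "r \<in> {0..}"
  have "((\<lambda>h. K * norm (T h x - x)) \<longlongrightarrow> K * norm (x - x)) (at_right 0)"
    by (intro tendsto_intros T_tendsto_0)
  then have "((\<lambda>s. K * norm (T \<bar>s - r\<bar> x - x)) \<longlongrightarrow> 0) (at r within {0..})"
    using filterlim_compose[OF _ filterlim_abs_diff_at_right_0] by simp
  moreover have "\<forall>\<^sub>F s in at r within {0..}. norm (T s x - T r x) \<le> K * norm (T \<bar>s - r\<bar> x - x)"
    using r by (auto simp: eventually_at_filter intro!: always_eventually norm_T_diff_le)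
  ultimately have "((\<lambda>s. T s x - T r x) \<longlongrightarrow> 0) (at r within {0..})"
    by (rule Lim_null_comparison[rotated])
  then show "((\<lambda>s. T s x) \<longlongrightarrow> T r x) (at r within {0..})"
    by (rule LIM_zero_cancel)
qed

lemma continuous_on_scaled_orbit:
  assumes "0 \<le> t"
  shows "continuous_on {0..1} (\<lambda>s. T (t * s) x)"
  using assms by (intro continuous_on_compose2[OF continuous_on_orbit]) (auto intro!: continuous_intros)

lemma generator_tendsto: "x \<in> D \<Longrightarrow> ((\<lambda>h. (1 / h) *\<^sub>R (T h x - x)) \<longlongrightarrow> - A x) (at_right 0)"
  using generator by (simp add: is_generator_def)

lemma in_D_iff: "x \<in> D \<longleftrightarrow> (\<exists>y. ((\<lambda>h. (1 / h) *\<^sub>R (T h x - x)) \<longlongrightarrow> y) (at_right 0))"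
  using generator by (simp add: is_generator_def)

lemma
  assumes x: "x \<in> D" and t: "0 \<le> t"
  shows T_in_D: "T t x \<in> D" and A_T: "A (T t x) = T t (A x)"
proof -
  have "((\<lambda>h. T t ((1 / h) *\<^sub>R (T h x - x))) \<longlongrightarrow> T t (- A x)) (at_right 0)"
    by (intro bounded_linear.tendsto[OF T_bounded_linear[OF t]] generator_tendsto x)
  moreover have "\<forall>\<^sub>F h in at_right 0. T t ((1 / h) *\<^sub>R (T h x - x)) = (1 / h) *\<^sub>R (T h (T t x) - T t x)"
    unfolding eventually_at_right_field
    using t by (intro exI[of _ 1]) (auto simp: T_linear_simps T_add[symmetric] add.commute)
  ultimately have "((\<lambda>h. (1 / h) *\<^sub>R (T h (T t x) - T t x)) \<longlongrightarrow> T t (- A x)) (at_right 0)"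
    by (rule Lim_transform_eventually)
  then have lim: "((\<lambda>h. (1 / h) *\<^sub>R (T h (T t x) - T t x)) \<longlongrightarrow> - T t (A x)) (at_right 0)"
    using t by (simp add: T_linear_simps)
  then show "T t x \<in> D" unfolding in_D_iff by blast
  from tendsto_unique[OF _ generator_tendsto[OF this] lim] show "A (T t x) = T t (A x)"
    by simp
qed

text \<open>
  The generator only provides the right derivative at 0. For the left derivative at \<open>t\<close> the
  operator \<open>T s\<close> with \<open>s < t\<close> is factored out, which compares \<open>T h x - x\<close> with \<open>- h *\<^sub>R T h (A x)\<close>, where
  \<open>h = t - s\<close>, and strong continuity at \<open>A x\<close> takes care of the difference to \<open>- h *\<^sub>R A x\<close>.
\<close>

lemma has_vector_derivative_orbit:
  assumes x: "x \<in> D" and t: "0 \<le> t"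
  shows "((\<lambda>s. T s x) has_vector_derivative - T t (A x)) (at t within {0..})"
proof -
  let ?g = "\<lambda>h. norm ((1 / h) *\<^sub>R (T h x - x) + A x) + norm (T h (A x) - A x)"
  have le: "norm (T s x - T t x - (s - t) *\<^sub>R (- T t (A x))) / norm (s - t) \<le> K * ?g \<bar>s - t\<bar>"
    if s: "0 \<le> s" "s \<noteq> t" for s
  proof -
    define h where "h = \<bar>s - t\<bar>"
    have h: "0 < h" using s by (simp add: h_def)
    define e where "e = (1 / h) *\<^sub>R (T h x - x) + A x"
    have e: "T h x = x - h *\<^sub>R A x + h *\<^sub>R e"
      using h by (simp add: e_def scaleR_add_right scaleR_diff_right)
    show ?thesis
    proof (cases "t < s")
      case True
      then have st: "s - t = h" and "T s x = T t (T h x)"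
        using t T_add[of t h x] by (simp_all add: h_def)
      then have "T s x - T t x - (s - t) *\<^sub>R (- T t (A x)) = T t (h *\<^sub>R e)"
        using t by (simp add: e T_linear_simps)
      then have "norm (T s x - T t x - (s - t) *\<^sub>R (- T t (A x))) \<le> K * (h * norm e)"
        using norm_T_le[OF t, of "h *\<^sub>R e"] h by simp
      also have "\<dots> \<le> K * (h * (norm e + norm (T h (A x) - A x)))"
        using h K_ge_1 by (intro mult_left_mono) auto
      finally show ?thesis
        using h by (simp add: divide_le_eq mult_ac h_def[symmetric] e_def[symmetric])
    next
      case False
      then have st: "s - t = - h" and ts: "T t y = T s (T h y)" for y
        using s T_add[of s h y] by (simp_all add: h_def)
      have "T s x - T t x - (s - t) *\<^sub>R (- T t (A x)) = - T s (h *\<^sub>R (e + (T h (A x) - A x)))"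
        unfolding ts e st using s
        by (simp add: T_linear_simps scaleR_add_right scaleR_diff_right)
      then have "norm (T s x - T t x - (s - t) *\<^sub>R (- T t (A x)))
          \<le> K * (h * norm (e + (T h (A x) - A x)))"
        using norm_T_le[OF s(1), of "h *\<^sub>R (e + (T h (A x) - A x))"] h by simp
      also have "\<dots> \<le> K * (h * (norm e + norm (T h (A x) - A x)))"
        using h K_ge_1 by (intro mult_left_mono norm_triangle_ineq) auto
      finally show ?thesis
        using h by (simp add: divide_le_eq mult_ac h_def[symmetric] e_def[symmetric])
    qed
  qed
  have "((\<lambda>h. K * ?g h) \<longlongrightarrow> K * (norm (- A x + A x) + norm (A x - A x))) (at_right 0)"
    by (intro tendsto_intros T_tendsto_0 generator_tendsto x)
  then have lim: "((\<lambda>s. K * ?g \<bar>s - t\<bar>) \<longlongrightarrow> 0) (at t within {0..})"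
    using filterlim_compose[OF _ filterlim_abs_diff_at_right_0] by simp
  have ev: "\<forall>\<^sub>F s in at t within {0..}.
      norm (norm (T s x - T t x - (s - t) *\<^sub>R (- T t (A x))) / norm (s - t)) \<le> K * ?g \<bar>s - t\<bar>"
    using le by (simp add: eventually_at_filter)
  show ?thesis
    unfolding has_vector_derivative_def has_derivative_iff_norm
    by (intro conjI bounded_linear_scaleR_left Lim_null_comparison[OF ev lim])
qed

lemma norm_orbit_diff_le:
  assumes x: "x \<in> D" and "0 \<le> r" "0 \<le> s"
  shows "norm (T s x - T r x) \<le> K * norm (A x) * \<bar>s - r\<bar>"
proof -
  have "norm (T s x - T r x) \<le> K * norm (A x) * norm (s - r)"
  proof (rule differentiable_bound[of "{0..}" "\<lambda>s. T s x" "\<lambda>t h. h *\<^sub>R (- T t (A x))"])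
    fix t :: real assume "t \<in> {0..}"
    then show "((\<lambda>s. T s x) has_derivative (\<lambda>h. h *\<^sub>R (- T t (A x)))) (at t within {0..})"
      using has_vector_derivative_orbit[OF x, of t] by (simp add: has_vector_derivative_def)
    show "onorm (\<lambda>h. h *\<^sub>R (- T t (A x))) \<le> K * norm (A x)"
      using norm_T_le[of t "A x"] \<open>t \<in> {0..}\<close> K_ge_1
      by (intro onorm_bound) (auto simp: mult.commute[of "K * _"] intro: mult_left_mono)
  qed (use assms in auto)
  then show ?thesis by simp
qed

definition res :: "real \<Rightarrow> 'a \<Rightarrow> 'a"
  where "res s = inv_into D (\<lambda>x. (\<i> * complex_of_real s) *\<^sub>C x + A x)"

lemma bij_betw_shifted: "bij_betw (\<lambda>x. (\<i> * complex_of_real s) *\<^sub>C x + A x) D UNIV"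
  and res_bounded_clinear: "bounded_clinear (res s)"
proof -
  let ?z = "- (\<i> * complex_of_real s)"
  let ?f = "\<lambda>x. ?z *\<^sub>C x - A x"
  have "?z \<in> resolvent_set D A"
    using imaginary_resolvent by (auto simp: op_spectrum_def)
  then have bij: "bij_betw ?f D UNIV" and lin: "bounded_clinear (inv_into D ?f)"
    by (auto simp: resolvent_set_def)
  have eq: "(\<lambda>x. (\<i> * complex_of_real s) *\<^sub>C x + A x) = uminus \<circ> ?f"
    by (simp add: fun_eq_iff scaleC_minus_left)
  have "bij_betw (uminus :: 'a \<Rightarrow> 'a) UNIV UNIV"
    by (rule bij_betw_byWitness[of _ uminus]) auto
  then show bij': "bij_betw (\<lambda>x. (\<i> * complex_of_real s) *\<^sub>C x + A x) D UNIV"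
    unfolding eq by (rule bij_betw_trans[OF bij])
  have res_eq: "res s y = inv_into D ?f (- y)" for y
  proof -
    have "- y \<in> ?f ` D"
      unfolding bij_betw_imp_surj_on[OF bij] ..
    then obtain x where x: "- y = ?f x" "x \<in> D"
      by (rule imageE)
    have "(\<i> * complex_of_real s) *\<^sub>C x + A x = - ?f x"
      by (simp add: scaleC_minus_left)
    also have "\<dots> = y"
      by (simp flip: x(1))
    finally have "(\<i> * complex_of_real s) *\<^sub>C x + A x = y" .
    then have "res s y = x"
      using inv_into_f_f[OF bij_betw_imp_inj_on[OF bij'] x(2)] by (simp add: res_def)
    moreover have "inv_into D ?f (- y) = x"
      using inv_into_f_f[OF bij_betw_imp_inj_on[OF bij] x(2)] by (simp only: x(1))
    ultimately show ?thesis by simp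
  qed
  have "bounded_linear (\<lambda>y. inv_into D ?f (- y))"
    using lin unfolding bounded_clinear_def
    by (intro bounded_linear_compose[OF _ bounded_linear_minus[OF bounded_linear_ident]]) (rule conjunct1)
  moreover have "inv_into D ?f (- (c *\<^sub>C y)) = c *\<^sub>C inv_into D ?f (- y)" for c y
    using lin unfolding bounded_clinear_def scaleC_minus_right[symmetric] by blast
  moreover have "res s = (\<lambda>y. inv_into D ?f (- y))"
    by (rule ext) (rule res_eq)
  ultimately show "bounded_clinear (res s)"
    unfolding bounded_clinear_def by (simp only:) blast
qed

lemma res_bounded_linear: "bounded_linear (res s)"
  using res_bounded_clinear by (simp add: bounded_clinear_def)

lemma res_scaleC: "res s (c *\<^sub>C x) = c *\<^sub>C res s x"
  using res_bounded_clinear by (simp add: bounded_clinear_def)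

lemma res_in_D: "res s y \<in> D"
  and res_solves: "(\<i> * complex_of_real s) *\<^sub>C res s y + A (res s y) = y"
  using bij_betw_shifted[of s] unfolding res_def bij_betw_def
  by (auto intro: inv_into_into f_inv_into_f[of y "\<lambda>x. (\<i> * complex_of_real s) *\<^sub>C x + A x"])

lemma res_eqI: "x \<in> D \<Longrightarrow> (\<i> * complex_of_real s) *\<^sub>C x + A x = y \<Longrightarrow> res s y = x"
  using bij_betw_shifted[of s] unfolding res_def bij_betw_def by (auto intro: inv_into_f_f)

lemma res_0_eq: "res 0 = inv_into D A"
  by (simp add: res_def)

lemma A_res_0: "A (res 0 y) = y"
  using res_solves[of 0 y] by simp

lemma resolvent_identity:
  "res r y = res s y + (\<i> * complex_of_real (s - r)) *\<^sub>C res s (res r y)"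
proof -
  let ?x = "res r y"
  have "res s (y + (\<i> * complex_of_real (s - r)) *\<^sub>C ?x) = ?x"
  proof (rule res_eqI[OF res_in_D])
    show "(\<i> * complex_of_real s) *\<^sub>C ?x + A ?x = y + (\<i> * complex_of_real (s - r)) *\<^sub>C ?x"
      using res_solves[of r y] by (simp add: right_diff_distrib scaleC_diff_left algebra_simps)
  qed
  then show ?thesis
    by (simp add: linear_add[OF bounded_linear.linear[OF res_bounded_linear]] res_scaleC)
qed

lemma res_T: "0 \<le> t \<Longrightarrow> res s (T t y) = T t (res s y)"
  by (rule res_eqI)
    (auto intro!: T_in_D res_in_D
      simp: A_T[OF res_in_D] res_solves simp flip: T_scaleC T_linear_simps(1))

text \<open>
  By the resolvent identity, a bound \<open>B\<close> at \<open>r\<close> implies the bound \<open>2 * B\<close> within distance \<open>1 / (2 * B)\<close>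
  of \<open>r\<close>; compactness does the rest.
\<close>

lemma res_bounded_on_compact:
  assumes "a \<le> b"
  shows "\<exists>B. \<forall>s\<in>{a..b}. \<forall>x. norm (res s x) \<le> B * norm x"
  using assms
proof (induction rule: Bolzano)
  case (trans a b c)
  then obtain B1 B2 where B: "\<And>s x. s \<in> {a..b} \<Longrightarrow> norm (res s x) \<le> B1 * norm x"
    "\<And>s x. s \<in> {b..c} \<Longrightarrow> norm (res s x) \<le> B2 * norm x"
    by blast
  have "norm (res s x) \<le> max B1 B2 * norm x" if "s \<in> {a..c}" for s x
  proof (cases "s \<le> b")
    case True
    then have "norm (res s x) \<le> B1 * norm x" using B(1) that by simp
    also have "\<dots> \<le> max B1 B2 * norm x" by (intro mult_right_mono) auto
    finally show ?thesis .
  next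
    case False
    then have "norm (res s x) \<le> B2 * norm x" using B(2) that by simp
    also have "\<dots> \<le> max B1 B2 * norm x" by (intro mult_right_mono) auto
    finally show ?thesis .
  qed
  then show ?case by blast
next
  case (local r)
  obtain B where B: "\<And>x. norm (res r x) \<le> norm x * B" "0 < B"
    using bounded_linear.pos_bounded[OF res_bounded_linear[of r]] by blast
  have close: "norm (res s x) \<le> 2 * B * norm x" if s: "\<bar>s - r\<bar> \<le> 1 / (2 * B)" for s x
  proof -
    have "norm (res s x) \<le> norm (res r x) + norm ((\<i> * complex_of_real (r - s)) *\<^sub>C res r (res s x))"
      using resolvent_identity[of s x r] by (metis norm_triangle_ineq)
    also have "norm ((\<i> * complex_of_real (r - s)) *\<^sub>C res r (res s x)) = \<bar>s - r\<bar> * norm (res r (res s x))"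
      by (simp only: norm_scaleC norm_mult norm_ii norm_of_real mult_1_left abs_minus_commute)
    also have "\<dots> \<le> 1 / (2 * B) * (norm (res s x) * B)"
      using s B by (intro mult_mono) auto
    finally show ?thesis using B(1)[of x] B(2) by (simp add: mult_ac)
  qed
  show ?case
  proof (rule exI[of _ "1 / (2 * B)"], intro conjI allI impI)
    show "0 < 1 / (2 * B)" using B by simp
    fix a b assume "a \<le> r \<and> r \<le> b \<and> b - a < 1 / (2 * B)"
    then show "\<exists>B. \<forall>s\<in>{a..b}. \<forall>x. norm (res s x) \<le> B * norm x"
      by (intro exI[of _ "2 * B"]) (auto intro!: close)
  qed
qed

section \<open>Decay from bounds on powers of the resolvent\<close>

lemma continuous_on_windowed_orbit:
  assumes "continuous_on {0..1} \<phi>" and "0 \<le> t"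
  shows "continuous_on {0..1} (\<lambda>s. \<phi> s *\<^sub>R T (t * s) y)"
  by (intro continuous_intros continuous_on_scaled_orbit assms)

text \<open>
  Integration by parts for the orbit of \<open>w = res (2 * pi * k / t) y\<close>. The derivatives of
  \<open>fmode (- k)\<close> and of the orbit combine to \<open>- t\<close> times the operator \<open>\<i> (2 \<pi> k / t) + A\<close>, which maps
  \<open>w\<close> to \<open>y\<close>.
\<close>

lemma fcoeff_windowed_orbit_step:
  assumes \<phi>: "\<And>s. (\<phi> has_real_derivative \<phi>' s) (at s)"
    and cont: "continuous_on {0..1} \<phi>'"
    and ends: "\<phi> 0 = 0" "\<phi> 1 = 0" and t: "0 < t"
  shows "fcoeff (\<lambda>s. \<phi> s *\<^sub>R T (t * s) y) k
       = (1 / t) *\<^sub>R fcoeff (\<lambda>s. \<phi>' s *\<^sub>R T (t * s) (res (2 * pi * k / t) y)) k"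
proof -
  define w where "w = res (2 * pi * k / t) y"
  let ?e = "fmode (- k)"
  have w: "w \<in> D" "y = (\<i> * complex_of_real (2 * pi * k / t)) *\<^sub>C w + A w"
    unfolding w_def by (rule res_in_D, rule res_solves[symmetric])
  have cont\<phi>: "continuous_on {0..1} \<phi>"
    by (meson \<phi> DERIV_continuous_on has_field_derivative_at_within)
  have deriv: "((\<lambda>s. ?e s *\<^sub>C (\<phi> s *\<^sub>R T (t * s) w)) has_vector_derivative
      ?e s *\<^sub>C (\<phi>' s *\<^sub>R T (t * s) w) - t *\<^sub>R (?e s *\<^sub>C (\<phi> s *\<^sub>R T (t * s) y))) (at s within {0..1})"
    if s: "s \<in> {0..1}" for s
  proof -
    have "((\<lambda>r. T r w) \<circ> (\<lambda>s. t * s) has_vector_derivative t *\<^sub>R (- T (t * s) (A w))) (at s within {0..1})"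
    proof (rule vector_diff_chain_within)
      show "((\<lambda>s. t * s) has_vector_derivative t) (at s within {0..1})"
        by (auto intro!: derivative_eq_intros simp flip: has_real_derivative_iff_has_vector_derivative)
      show "((\<lambda>r. T r w) has_vector_derivative - T (t * s) (A w)) (at (t * s) within (\<lambda>s. t * s) ` {0..1})"
        using s t by (intro has_vector_derivative_within_subset[OF has_vector_derivative_orbit[OF w(1)]]) auto
    qed
    then have orbit: "((\<lambda>s. T (t * s) w) has_vector_derivative t *\<^sub>R (- T (t * s) (A w))) (at s within {0..1})"
      by (simp add: o_def)
    have "T (t * s) y = (\<i> * complex_of_real (2 * pi * k / t)) *\<^sub>C T (t * s) w + T (t * s) (A w)"
      using s t by (subst w(2)) (simp add: T_linear_simps T_scaleC)
    moreover have "t *\<^sub>R ((\<i> * complex_of_real (2 * pi * k / t)) *\<^sub>C v)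
        = (\<i> * complex_of_real (2 * pi * k)) *\<^sub>C v" for v :: 'a
    proof -
      have "complex_of_real t * (\<i> * complex_of_real (2 * pi * k / t)) = \<i> * complex_of_real (2 * pi * k)"
        using t by simp
      then show ?thesis
        by (simp only: scaleR_scaleC scaleC_scaleC)
    qed
    ultimately have "t *\<^sub>R T (t * s) y = (\<i> * complex_of_real (2 * pi * k)) *\<^sub>C T (t * s) w + t *\<^sub>R T (t * s) (A w)"
      by (simp only: scaleR_add_right)
    then have Aw: "t *\<^sub>R T (t * s) (A w) = t *\<^sub>R T (t * s) y - (\<i> * complex_of_real (2 * pi * k)) *\<^sub>C T (t * s) w"
      by simp
    have modulation: "((2 * pi * of_int (- k)) *\<^sub>R (\<i> * ?e s)) *\<^sub>C v
        = - (?e s *\<^sub>C ((\<i> * complex_of_real (2 * pi * k)) *\<^sub>C v))" for v :: 'a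
      by (simp add: scaleR_conv_of_real scaleC_scaleC scaleC_minus_left mult_ac)
    have "((\<lambda>s. ?e s *\<^sub>C (\<phi> s *\<^sub>R T (t * s) w)) has_vector_derivative
        ?e s *\<^sub>C (\<phi> s *\<^sub>R (t *\<^sub>R (- T (t * s) (A w))) + \<phi>' s *\<^sub>R T (t * s) w)
        + ((2 * pi * of_int (- k)) *\<^sub>R (\<i> * ?e s)) *\<^sub>C (\<phi> s *\<^sub>R T (t * s) w)) (at s within {0..1})"
      by (intro bounded_bilinear.has_vector_derivative[OF bounded_bilinear_scaleC]
          has_vector_derivative_fmode has_vector_derivative_scaleR orbit
          has_field_derivative_at_within[OF \<phi>])
    also have "?e s *\<^sub>C (\<phi> s *\<^sub>R (t *\<^sub>R (- T (t * s) (A w))) + \<phi>' s *\<^sub>R T (t * s) w)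
        + ((2 * pi * of_int (- k)) *\<^sub>R (\<i> * ?e s)) *\<^sub>C (\<phi> s *\<^sub>R T (t * s) w)
      = ?e s *\<^sub>C (\<phi>' s *\<^sub>R T (t * s) w) - t *\<^sub>R (?e s *\<^sub>C (\<phi> s *\<^sub>R T (t * s) y))"
      unfolding scaleR_minus_right Aw modulation
      by (simp add: scaleC_add_right scaleC_diff_right scaleC_minus_right
          scaleR_diff_right scaleC_scaleR mult.commute)
    finally show ?thesis .
  qed
  have "((\<lambda>s. ?e s *\<^sub>C (\<phi>' s *\<^sub>R T (t * s) w) - t *\<^sub>R (?e s *\<^sub>C (\<phi> s *\<^sub>R T (t * s) y)))
      has_integral ?e 1 *\<^sub>C (\<phi> 1 *\<^sub>R T (t * 1) w) - ?e 0 *\<^sub>C (\<phi> 0 *\<^sub>R T (t * 0) w)) {0..1}"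
    by (intro fundamental_theorem_of_calculus deriv) auto
  then have 0: "((\<lambda>s. ?e s *\<^sub>C (\<phi>' s *\<^sub>R T (t * s) w) - t *\<^sub>R (?e s *\<^sub>C (\<phi> s *\<^sub>R T (t * s) y)))
      has_integral 0) {0..1}"
    using ends by simp
  have "((\<lambda>s. ?e s *\<^sub>C (\<phi>' s *\<^sub>R T (t * s) w) - t *\<^sub>R (?e s *\<^sub>C (\<phi> s *\<^sub>R T (t * s) y)))
      has_integral (fcoeff (\<lambda>s. \<phi>' s *\<^sub>R T (t * s) w) k - t *\<^sub>R fcoeff (\<lambda>s. \<phi> s *\<^sub>R T (t * s) y) k)) {0..1}"
    unfolding fcoeff_def
    using t by (intro has_integral_diff has_integral_cmul integrable_integral integrable_continuous_real
        continuous_intros continuous_on_windowed_orbit cont cont\<phi>) auto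
  from has_integral_unique[OF 0 this] show ?thesis
    using t by (simp add: w_def)
qed

lemma fcoeff_bounded_clinear:
  assumes "bounded_clinear h" and f: "continuous_on {0..1} f"
  shows "fcoeff (\<lambda>s. h (f s)) k = h (fcoeff f k)"
proof -
  have "integral {0..1} (h \<circ> (\<lambda>s. fmode (- k) s *\<^sub>C f s)) = h (fcoeff f k)"
    unfolding fcoeff_def using assms
    by (intro integral_linear integrable_continuous_real continuous_intros f)
      (auto simp: bounded_clinear_def)
  then show ?thesis
    using assms by (simp add: fcoeff_def o_def bounded_clinear_def)
qed

text \<open>
  The \<open>j\<close>-th derivative of the polynomial \<open>(u (1 - u))\<^sup>n\<close>. It vanishes at 0 and 1 as long as \<open>j < n\<close>, so
  that \<open>n\<close> integrations by parts leave no boundary terms.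
\<close>

definition window :: "nat \<Rightarrow> nat \<Rightarrow> real poly"
  where "window n j = (pderiv ^^ j) ([:0, 1, - 1:] ^ n)"

lemma pderiv_power_Suc_mult:
  fixes p q :: "real poly"
  shows "pderiv (q ^ Suc m * p) = q ^ m * (q * pderiv p + smult (of_nat (Suc m)) (pderiv q * p))"
  unfolding pderiv_mult pderiv_power_Suc by (simp add: algebra_simps del: of_nat_Suc)

lemma window_dvd: "j \<le> n \<Longrightarrow> [:0, 1, - 1:] ^ (n - j) dvd window n j"
proof (induction j)
  case 0
  then show ?case by (simp add: window_def)
next
  case (Suc j)
  let ?q = "[:0, 1, - 1:] :: real poly"
  obtain m where m: "n - j = Suc m" "n - Suc j = m"
    using Suc.prems by (cases "n - j") auto
  obtain p where p: "window n j = ?q ^ Suc m * p"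
    using Suc m by (auto simp: dvd_def)
  have "window n (Suc j) = pderiv (?q ^ Suc m * p)"
    unfolding p[symmetric] by (simp add: window_def)
  also have "\<dots> = ?q ^ m * (?q * pderiv p + smult (of_nat (Suc m)) (pderiv ?q * p))"
    by (rule pderiv_power_Suc_mult)
  finally show ?case by (simp add: m)
qed

lemma window_ends:
  assumes "j < n"
  shows "poly (window n j) 0 = 0" "poly (window n j) 1 = 0"
proof -
  have "([:0, 1, - 1:] :: real poly) dvd window n j"
    using assms window_dvd[of j n] dvd_trans dvd_power[of "n - j" "[:0, 1, - 1:] :: real poly"]
    by fastforce
  then show "poly (window n j) 0 = 0" "poly (window n j) 1 = 0"
    by (auto simp: dvd_def)
qed

lemma window_deriv: "((\<lambda>s. poly (window n j) s) has_real_derivative poly (window n (Suc j)) s) (at s)"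
  by (simp add: window_def poly_DERIV)

lemma continuous_on_window: "continuous_on S (\<lambda>s. poly (window n j) s)"
  by (intro continuous_intros)

lemma window_bounded:
  "\<exists>B>0. \<forall>s\<in>{0..1}. \<bar>poly (window n j) s\<bar> \<le> B"
proof -
  have "compact ((\<lambda>s. poly (window n j) s) ` {0..1})"
    by (intro compact_continuous_image continuous_on_window) auto
  then show ?thesis
    using compact_imp_bounded[of "(\<lambda>s. poly (window n j) s) ` {0..1}"]
    by (auto simp: bounded_pos)
qed

lemma integral_window_pos: "0 < integral {0..1} (\<lambda>s. (poly (window n 0) s)\<^sup>2)"
proof -
  have "poly (window n 0) (1 / 2) \<noteq> 0"
    by (simp add: window_def)
  then have "integral {0..1} (\<lambda>s. (poly (window n 0) s)\<^sup>2) \<noteq> 0"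
    by (subst integral_eq_0_iff)
      (auto intro!: continuous_intros continuous_on_window bexI[of _ "1 / 2"])
  moreover have "0 \<le> integral {0..1} (\<lambda>s. (poly (window n 0) s)\<^sup>2)"
    by (intro integral_nonneg integrable_continuous_real continuous_intros continuous_on_window) auto
  ultimately show ?thesis by linarith
qed

lemma fcoeff_windowed_orbit:
  assumes t: "0 < t" and "j \<le> n"
  shows "fcoeff (\<lambda>s. poly (window n 0) s *\<^sub>R T (t * s) y) k =
     (1 / t ^ j) *\<^sub>R fcoeff (\<lambda>s. poly (window n j) s *\<^sub>R T (t * s) ((res (2 * pi * k / t) ^^ j) y)) k"
  using \<open>j \<le> n\<close>
proof (induction j)
  case (Suc j)
  then show ?case
    using fcoeff_windowed_orbit_step[OF window_deriv continuous_on_window window_ends, of j n t] t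
    by (simp add: mult.commute)
qed simp

lemma res_power_bounded_clinear: "bounded_clinear (res s ^^ n)"
proof (induction n)
  case 0
  then show ?case by (simp add: bounded_clinear_def bounded_linear_ident id_def)
next
  case (Suc n)
  then show ?case
    using res_bounded_clinear[of s]
    by (auto simp: bounded_clinear_def o_def intro: bounded_linear_compose[of "res s"])
qed

lemma res_power_T: "0 \<le> t \<Longrightarrow> (res s ^^ n) (T t y) = T t ((res s ^^ n) y)"
  by (induction n) (simp_all add: res_T)

lemma fcoeff_windowed_orbit_res_0:
  assumes t: "0 < t"
  shows "fcoeff (\<lambda>s. poly (window n 0) s *\<^sub>R T (t * s) (res 0 x)) k =
     (1 / t ^ n) *\<^sub>R (res (2 * pi * k / t) ^^ n) (res 0 (fcoeff (\<lambda>s. poly (window n n) s *\<^sub>R T (t * s) x) k))"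
proof -
  let ?h = "\<lambda>y. (res (2 * pi * k / t) ^^ n) (res 0 y)"
  have h: "bounded_clinear ?h"
    using res_power_bounded_clinear[where s = "2 * pi * k / t" and n = n] res_bounded_clinear[of 0]
    by (auto simp: bounded_clinear_def intro: bounded_linear_compose)
  then interpret h: bounded_linear ?h by (simp add: bounded_clinear_def)
  have "fcoeff (\<lambda>s. poly (window n n) s *\<^sub>R T (t * s) (?h x)) k
      = fcoeff (\<lambda>s. ?h (poly (window n n) s *\<^sub>R T (t * s) x)) k"
    unfolding fcoeff_def using t
    by (intro integral_cong) (auto simp: h.scaleR res_power_T res_T)
  also have "\<dots> = ?h (fcoeff (\<lambda>s. poly (window n n) s *\<^sub>R T (t * s) x) k)"
    using t by (intro fcoeff_bounded_clinear h continuous_on_windowed_orbit continuous_on_window) auto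
  finally show ?thesis
    using fcoeff_windowed_orbit[OF t, OF order_refl, where y = "res 0 x" and k = k] by simp
qed


text \<open>
  The windowed orbit \<open>s \<mapsto> poly (window n 0) s *\<^sub>R T (t * s) (res 0 x)\<close> vanishes at both ends of
  the unit interval and has Lipschitz constant of order \<open>t\<close>, so that discarding the Fourier
  coefficients of index above \<open>2 * m\<close>, with \<open>m\<close> of order \<open>r * t\<close>, costs \<open>1 / r\<close>. Its low Fourier coefficients are those of a bounded
  function, multiplied by \<open>res \<omega> ^^ n \<circ> res 0\<close> with \<open>\<bar>\<omega>\<bar> \<le> r\<close> and by \<open>1 / t ^ n\<close>. By boundedness of
  the semigroup, the mean square over the whole interval controls the value at its end.
\<close>

lemma orbit_decay:
  assumes n: "1 \<le> n"
  obtains C where "0 < C" and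
    "\<And>t r G x. \<lbrakk>1 \<le> t; 0 < r; 4 * pi \<le> t * r; 0 \<le> G;
       \<And>s y. \<bar>s\<bar> \<le> r \<Longrightarrow> norm ((res s ^^ n) (res 0 y)) \<le> G * norm y\<rbrakk>
     \<Longrightarrow> norm (T t (res 0 x)) \<le> C * (1 / r + G / t ^ n) * norm x"
proof -
  obtain B0 where B0: "0 < B0" "\<And>s. s \<in> {0..1} \<Longrightarrow> \<bar>poly (window n 0) s\<bar> \<le> B0"
    using window_bounded[of n 0] by blast
  obtain B1 where B1: "0 < B1" "\<And>s. s \<in> {0..1} \<Longrightarrow> \<bar>poly (window n 1) s\<bar> \<le> B1"
    using window_bounded[of n 1] by blast
  obtain Bn where Bn: "0 < Bn" "\<And>s. s \<in> {0..1} \<Longrightarrow> \<bar>poly (window n n) s\<bar> \<le> Bn"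
    using window_bounded[of n n] by blast
  obtain R where R: "0 < R" "\<And>x. norm (res 0 x) \<le> R * norm x"
    using bounded_linear.pos_bounded[OF res_bounded_linear[of 0]] by (auto simp: mult.commute)
  define c where "c = integral {0..1} (\<lambda>s. (poly (window n 0) s)\<^sup>2)"
  have c: "0 < c"
    unfolding c_def by (rule integral_window_pos)
  define E where "E = K * (B1 * R + B0)"
  have E: "0 < E" using B0(1) B1(1) R(1) K_ge_1 by (simp add: E_def add_pos_pos)
  define C where "C = K * (16 * pi * E + Bn * K) / sqrt c"
  have C: "0 < C" using E Bn(1) K_ge_1 c by (simp add: C_def add_pos_pos)
  have main: "norm (T t (res 0 x)) \<le> C * (1 / r + G / t ^ n) * norm x"
    if t: "1 \<le> t" and r: "0 < r" and tr: "4 * pi \<le> t * r" and G: "0 \<le> G"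
      and res_G: "\<And>s y. \<bar>s\<bar> \<le> r \<Longrightarrow> norm ((res s ^^ n) (res 0 y)) \<le> G * norm y" for t r G x
  proof -
    define f where "f = (\<lambda>s. poly (window n 0) s *\<^sub>R T (t * s) (res 0 x))"
    define g where "g = (\<lambda>s. poly (window n n) s *\<^sub>R T (t * s) x)"
    have cont_f: "continuous_on {0..1} f" and cont_g: "continuous_on {0..1} g"
      unfolding f_def g_def
      using t by (intro continuous_on_windowed_orbit continuous_on_window; simp)+
    have lip: "norm (f u - f s) \<le> (E * t * norm x) * \<bar>u - s\<bar>" if us: "u \<in> {0..1}" "s \<in> {0..1}" for u s
    proof -
      have "f u - f s = (poly (window n 0) u - poly (window n 0) s) *\<^sub>R T (t * u) (res 0 x)
          + poly (window n 0) s *\<^sub>R (T (t * u) (res 0 x) - T (t * s) (res 0 x))"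
        by (simp add: f_def scaleR_diff_left scaleR_diff_right)
      then have "norm (f u - f s) \<le> \<bar>poly (window n 0) u - poly (window n 0) s\<bar> * norm (T (t * u) (res 0 x))
          + \<bar>poly (window n 0) s\<bar> * norm (T (t * u) (res 0 x) - T (t * s) (res 0 x))"
        using norm_triangle_ineq by (metis norm_scaleR)
      also have "\<dots> \<le> (B1 * \<bar>u - s\<bar>) * (K * (R * norm x)) + B0 * (K * norm x * (t * \<bar>u - s\<bar>))"
      proof (intro add_mono mult_mono)
        have "norm (poly (window n 0) u - poly (window n 0) s) \<le> B1 * norm (u - s)"
          using us B1(2) window_deriv[of n 0]
          by (intro field_differentiable_bound[of "{0..1}" _ "poly (window n 1)"])
            (auto intro: has_field_derivative_at_within)
        then show "\<bar>poly (window n 0) u - poly (window n 0) s\<bar> \<le> B1 * \<bar>u - s\<bar>" by simp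
        have "norm (T (t * u) (res 0 x)) \<le> K * norm (res 0 x)"
          using us t by (intro norm_T_le) simp
        also have "\<dots> \<le> K * (R * norm x)"
          using K_ge_1 R(2) by (intro mult_left_mono) auto
        finally show "norm (T (t * u) (res 0 x)) \<le> K * (R * norm x)" .
        have "\<bar>t * u - t * s\<bar> = t * \<bar>u - s\<bar>"
          using t by (simp add: abs_mult flip: right_diff_distrib)
        then show "norm (T (t * u) (res 0 x) - T (t * s) (res 0 x)) \<le> K * norm x * (t * \<bar>u - s\<bar>)"
          using norm_orbit_diff_le[OF res_in_D, of "t * s" "t * u" 0 x] us t by (simp add: A_res_0)
      qed (use B0 B1 us in auto)
      also have "\<dots> \<le> (B1 * \<bar>u - s\<bar>) * (K * (R * norm x)) * t + B0 * (K * norm x * (t * \<bar>u - s\<bar>))"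
        using mult_left_mono[OF t, of "(B1 * \<bar>u - s\<bar>) * (K * (R * norm x))"] B1(1) K_ge_1 R(1)
        by simp
      also have "\<dots> = (E * t * norm x) * \<bar>u - s\<bar>"
        by (simp add: E_def algebra_simps)
      finally show ?thesis .
    qed
    have ends: "f 0 = f 1"
      using window_ends[of 0 n] n by (simp add: f_def)
    \<comment> \<open>The largest \<open>m\<close> for which \<open>\<bar>k\<bar> \<le> 2 * m\<close> implies \<open>\<bar>2 * pi * k / t\<bar> \<le> r\<close>.\<close>
    define m where "m = nat \<lfloor>t * r / (4 * pi)\<rfloor>"
    have fl: "1 \<le> \<lfloor>t * r / (4 * pi)\<rfloor>"
      using tr by simp
    then have "int m = \<lfloor>t * r / (4 * pi)\<rfloor>"
      unfolding m_def by linarith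
    then have "real m = of_int \<lfloor>t * r / (4 * pi)\<rfloor>" "1 \<le> m"
      using fl by linarith+
    then have m: "1 \<le> m" "m \<le> t * r / (4 * pi)" "t * r / (4 * pi) \<le> 2 * real m"
      by linarith+
    have low: "(\<Sum>k\<in>{- 2 * int m..2 * int m}. (norm (fcoeff f k))\<^sup>2) \<le> (G / t ^ n * (Bn * K * norm x))\<^sup>2"
    proof -
      have "(\<Sum>k\<in>{- 2 * int m..2 * int m}. (norm (fcoeff f k))\<^sup>2)
          \<le> (\<Sum>k\<in>{- 2 * int m..2 * int m}. (G / t ^ n)\<^sup>2 * (norm (fcoeff g k))\<^sup>2)"
      proof (rule sum_mono)
        fix k assume k: "k \<in> {- 2 * int m..2 * int m}"
        have "\<bar>real_of_int k\<bar> \<le> 2 * m"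
          using k by auto
        then have "2 * pi * \<bar>real_of_int k\<bar> \<le> 2 * pi * (2 * m)"
          by (intro mult_left_mono) auto
        also have "\<dots> \<le> t * r"
          using m(2) by (simp add: field_simps)
        finally have "\<bar>2 * pi * k / t\<bar> \<le> r"
          using t by (simp add: abs_mult divide_le_eq mult.commute)
        then have "norm (fcoeff f k) \<le> (1 / t ^ n) * (G * norm (fcoeff g k))"
          using res_G t unfolding f_def g_def
          by (subst fcoeff_windowed_orbit_res_0) (auto intro!: mult_left_mono divide_right_mono)
        then have "(norm (fcoeff f k))\<^sup>2 \<le> ((1 / t ^ n) * (G * norm (fcoeff g k)))\<^sup>2"
          by (intro power_mono) auto
        then show "(norm (fcoeff f k))\<^sup>2 \<le> (G / t ^ n)\<^sup>2 * (norm (fcoeff g k))\<^sup>2"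
          by (simp add: power_mult_distrib power_divide)
      qed
      also have "\<dots> \<le> (G / t ^ n)\<^sup>2 * integral {0..1} (\<lambda>s. (norm (g s))\<^sup>2)"
        unfolding sum_distrib_left[symmetric]
        by (intro mult_left_mono bessel_inequality cont_g) auto
      also have "\<dots> \<le> (G / t ^ n)\<^sup>2 * (Bn * K * norm x)\<^sup>2"
      proof (intro mult_left_mono)
        have "norm (g s) \<le> Bn * (K * norm x)" if "s \<in> {0..1}" for s
          using that Bn norm_T_le[of "t * s" x] t K_ge_1 by (auto simp: g_def intro!: mult_mono)
        then have "integral {0..1} (\<lambda>s. (norm (g s))\<^sup>2) \<le> integral {0..1} (\<lambda>s::real. (Bn * K * norm x)\<^sup>2)"
          by (intro integral_le integrable_continuous_real continuous_intros cont_g power_mono)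
            (auto simp: mult.assoc)
        then show "integral {0..1} (\<lambda>s. (norm (g s))\<^sup>2) \<le> (Bn * K * norm x)\<^sup>2"
          by simp
      qed auto
      finally show ?thesis
        unfolding power_mult_distrib[symmetric] .
    qed
    have high: "2 * (E * t * norm x) / m \<le> 16 * pi * E * norm x / r"
    proof -
      have "2 * (E * t * norm x) / m = 4 * (E * t * norm x) * (1 / (2 * m))"
        by simp
      also have "\<dots> \<le> 4 * (E * t * norm x) * (4 * pi / (t * r))"
        using m t r E by (intro mult_left_mono) (auto simp: field_simps)
      finally show ?thesis
        using t r by (simp add: field_simps)
    qed
    let ?z = "norm (T t (res 0 x))"
    have "c * ?z\<^sup>2 \<le> K\<^sup>2 * integral {0..1} (\<lambda>s. (norm (f s))\<^sup>2)"
    proof -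
      have "?z \<le> K * norm (T (t * s) (res 0 x))" if "s \<in> {0..1}" for s
      proof -
        have "T t (res 0 x) = T (t * (1 - s)) (T (t * s) (res 0 x))"
          using T_add[of "t * (1 - s)" "t * s"] that t by (simp add: algebra_simps)
        then show ?thesis
          using norm_T_le[of "t * (1 - s)"] that t by simp
      qed
      then have "(poly (window n 0) s)\<^sup>2 * ?z\<^sup>2 \<le> K\<^sup>2 * (norm (f s))\<^sup>2" if "s \<in> {0..1}" for s
      proof -
        have "(poly (window n 0) s)\<^sup>2 * ?z\<^sup>2 \<le> (poly (window n 0) s)\<^sup>2 * (K * norm (T (t * s) (res 0 x)))\<^sup>2"
          using that \<open>\<And>s. s \<in> {0..1} \<Longrightarrow> ?z \<le> K * norm (T (t * s) (res 0 x))\<close>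
          by (intro mult_left_mono power_mono) auto
        then show ?thesis
          by (simp add: f_def power_mult_distrib mult_ac)
      qed
      then have "integral {0..1} (\<lambda>s. (poly (window n 0) s)\<^sup>2 * ?z\<^sup>2) \<le> integral {0..1} (\<lambda>s. K\<^sup>2 * (norm (f s))\<^sup>2)"
        by (intro integral_le integrable_continuous_real continuous_intros continuous_on_window cont_f)
      then show ?thesis by (simp add: c_def)
    qed
    also have "\<dots> \<le> K\<^sup>2 * ((G / t ^ n * (Bn * K * norm x))\<^sup>2 + (16 * pi * E * norm x / r)\<^sup>2)"
    proof (intro mult_left_mono)
      have "integral {0..1} (\<lambda>s. (norm (f s))\<^sup>2)
          \<le> (\<Sum>k\<in>{- 2 * int m..2 * int m}. (norm (fcoeff f k))\<^sup>2) + (2 * (E * t * norm x) / m)\<^sup>2"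
        by (rule integral_norm2_le_low_frequencies[OF lip ends m(1)])
      also have "\<dots> \<le> (G / t ^ n * (Bn * K * norm x))\<^sup>2 + (16 * pi * E * norm x / r)\<^sup>2"
        using E t by (intro add_mono low power_mono high) auto
      finally show "integral {0..1} (\<lambda>s. (norm (f s))\<^sup>2)
          \<le> (G / t ^ n * (Bn * K * norm x))\<^sup>2 + (16 * pi * E * norm x / r)\<^sup>2" .
    qed auto
    also have "\<dots> \<le> K\<^sup>2 * (G / t ^ n * (Bn * K * norm x) + 16 * pi * E * norm x / r)\<^sup>2"
      using G t Bn(1) K_ge_1 E r by (intro mult_left_mono) (auto simp: power2_sum)
    finally have "(sqrt c * ?z)\<^sup>2 \<le> (K * (G / t ^ n * (Bn * K * norm x) + 16 * pi * E * norm x / r))\<^sup>2"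
      using c by (simp add: power_mult_distrib)
    then have "sqrt c * ?z \<le> K * (G / t ^ n * (Bn * K * norm x) + 16 * pi * E * norm x / r)"
      using G t Bn(1) K_ge_1 E r by (elim power2_le_imp_le) auto
    also have "\<dots> \<le> K * (16 * pi * E + Bn * K) * (1 / r + G / t ^ n) * norm x"
      using G t Bn(1) K_ge_1 E r by (auto simp: algebra_simps intro!: add_nonneg_nonneg)
    finally show ?thesis
      using c by (simp add: C_def field_simps)
  qed
  from that[OF C main] show ?thesis .
qed

end

section \<open>Slow variation\<close>

lemma slowly_varying_on_pos: "slowly_varying_on a l \<Longrightarrow> a \<le> s \<Longrightarrow> 0 < l s"
  by (simp add: slowly_varying_on_def)

lemma slowly_varying_on_tendsto: "slowly_varying_on a l \<Longrightarrow> 0 < c \<Longrightarrow> ((\<lambda>s. l (c * s) / l s) \<longlongrightarrow> 1) at_top"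
  by (simp add: slowly_varying_on_def)

text \<open>
  Potter's bound. By monotonicity it suffices to compare \<open>l s\<close> with \<open>l (2 ^ j * s)\<close> for the least \<open>j\<close>
  with \<open>r \<le> 2 ^ j * s\<close>, and there \<open>l (2 * s) \<le> 2 powr \<epsilon> * l s\<close> can be iterated.
\<close>

lemma slowly_varying_mono_potter:
  assumes l: "slowly_varying_on a l" and mono: "mono_on {a..} l" and \<epsilon>: "0 < \<epsilon>"
  obtains s0 where "a \<le> s0" "0 < s0"
    "\<And>s r. s0 \<le> s \<Longrightarrow> s \<le> r \<Longrightarrow> l r \<le> 2 powr \<epsilon> * (r / s) powr \<epsilon> * l s"
proof -
  have "\<forall>\<^sub>F s in at_top. l (2 * s) / l s < 2 powr \<epsilon>"
    using order_tendstoD(2)[OF slowly_varying_on_tendsto[OF l]] \<epsilon> by simp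
  then obtain s1 where s1: "\<And>s. s1 \<le> s \<Longrightarrow> l (2 * s) / l s < 2 powr \<epsilon>"
    by (auto simp: eventually_at_top_linorder)
  define s0 where "s0 = max 1 (max a s1)"
  have s0: "a \<le> s0" "0 < s0" "s1 \<le> s0" by (auto simp: s0_def)
  have iter: "l (2 ^ j * s) \<le> (2 powr \<epsilon>) ^ j * l s" if s: "s0 \<le> s" for j s
  proof (induction j)
    case (Suc j)
    have "s \<le> 2 ^ j * s"
      using s s0 by simp
    then have j: "s0 \<le> 2 ^ j * s" using s by linarith
    then have "l (2 * (2 ^ j * s)) \<le> 2 powr \<epsilon> * l (2 ^ j * s)"
      using s1[of "2 ^ j * s"] slowly_varying_on_pos[OF l, of "2 ^ j * s"] s0
      by (simp add: divide_less_eq)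
    also have "\<dots> \<le> 2 powr \<epsilon> * ((2 powr \<epsilon>) ^ j * l s)"
      using Suc by (intro mult_left_mono) auto
    finally show ?case by (simp add: mult_ac)
  qed simp
  have "l r \<le> 2 powr \<epsilon> * (r / s) powr \<epsilon> * l s" if s: "s0 \<le> s" "s \<le> r" for s r
  proof -
    define j where "j = nat \<lceil>log 2 (r / s)\<rceil>"
    have rs: "1 \<le> r / s" using s s0 by simp
    then have "0 \<le> log 2 (r / s)" by simp
    then have j: "log 2 (r / s) \<le> j" "j \<le> log 2 (r / s) + 1"
      unfolding j_def by linarith+
    have "r / s = 2 powr log 2 (r / s)" using rs by simp
    also have "\<dots> \<le> 2 powr j" using j(1) by (intro powr_mono) auto
    finally have r: "r \<le> 2 ^ j * s" using s s0 by (simp add: powr_realpow divide_le_eq)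
    have "l r \<le> l (2 ^ j * s)"
      using mono r s s0 by (auto intro: mono_onD)
    also have "\<dots> \<le> (2 powr \<epsilon>) ^ j * l s" by (rule iter[OF s(1)])
    also have "(2 powr \<epsilon>) ^ j = (2 powr j) powr \<epsilon>"
      by (simp add: powr_powr powr_power mult.commute)
    also have "\<dots> \<le> (2 powr (log 2 (r / s) + 1)) powr \<epsilon>"
      using j(2) \<epsilon> by (intro powr_mono2 powr_mono) auto
    also have "2 powr (log 2 (r / s) + 1) = 2 * (r / s)"
      using rs by (simp add: powr_add)
    also have "(2 * (r / s)) powr \<epsilon> = 2 powr \<epsilon> * (r / s) powr \<epsilon>"
      by (rule powr_mult)
    finally show ?thesis
      using slowly_varying_on_pos[OF l, of s] s s0 by (simp add: mult_right_mono)
  qed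
  with s0 that show ?thesis by blast
qed

text \<open>
  Potter's bound with exponent \<open>\<alpha> / 2\<close> shows that \<open>s powr \<alpha> / l s\<close> grows at least like \<open>s powr (\<alpha> / 2)\<close>,
  and the \<open>n\<close>-th power of the latter outweighs the denominator \<open>s\<close>.
\<close>

lemma regularly_varying_power_quotient_le:
  fixes n :: nat
  assumes l: "slowly_varying_on a l" and mono: "mono_on {a..} l" and \<alpha>: "0 < \<alpha>" and n: "1 \<le> \<alpha> / 2 * n"
  obtains s0 C where "a \<le> s0" "0 < s0" "0 < C"
    "\<And>s r. s0 \<le> s \<Longrightarrow> s \<le> r \<Longrightarrow> (s powr \<alpha> / l s) ^ n / s \<le> C * ((r powr \<alpha> / l r) ^ n / r)"
proof -
  define \<epsilon> where "\<epsilon> = \<alpha> / 2"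
  have \<epsilon>: "0 < \<epsilon>" "\<alpha> = \<epsilon> + \<epsilon>" using \<alpha> by (auto simp: \<epsilon>_def)
  obtain s0 where s0: "a \<le> s0" "0 < s0"
    and potter: "\<And>s r. s0 \<le> s \<Longrightarrow> s \<le> r \<Longrightarrow> l r \<le> 2 powr \<epsilon> * (r / s) powr \<epsilon> * l s"
    using slowly_varying_mono_potter[OF l mono \<epsilon>(1)] by blast
  have "(s powr \<alpha> / l s) ^ n / s \<le> (2 powr \<epsilon>) ^ n * ((r powr \<alpha> / l r) ^ n / r)" if s: "s0 \<le> s" "s \<le> r" for s r
  proof -
    have pos: "0 < s" "0 < r" "0 < l s" "0 < l r"
      using s s0 slowly_varying_on_pos[OF l] by auto
    have "s powr \<alpha> / l s = (s powr \<alpha> / (l s * l r)) * l r"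
      using pos by simp
    also have "\<dots> \<le> (s powr \<alpha> / (l s * l r)) * (2 powr \<epsilon> * (r / s) powr \<epsilon> * l s)"
      using potter[OF s] pos by (intro mult_left_mono) auto
    also have "\<dots> = 2 powr \<epsilon> * (r powr \<alpha> / l r) * (s / r) powr \<epsilon>"
    proof -
      have "u powr \<alpha> = u powr \<epsilon> * u powr \<epsilon>" for u :: real
        by (simp only: \<epsilon>(2) powr_add)
      then show ?thesis
        using pos by (simp add: powr_divide field_simps)
    qed
    finally have "(s powr \<alpha> / l s) ^ n \<le> (2 powr \<epsilon> * (r powr \<alpha> / l r) * (s / r) powr \<epsilon>) ^ n"
      using pos by (intro power_mono) auto
    also have "\<dots> = (2 powr \<epsilon>) ^ n * (r powr \<alpha> / l r) ^ n * (s / r) powr (\<epsilon> * n)"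
    proof -
      have "((s / r) powr \<epsilon>) ^ n = (s / r) powr (\<epsilon> * n)"
        using pos by (simp add: powr_power mult.commute)
      then show ?thesis
        by (simp only: power_mult_distrib)
    qed
    also have "\<dots> \<le> (2 powr \<epsilon>) ^ n * (r powr \<alpha> / l r) ^ n * (s / r) powr 1"
      using pos s n by (intro mult_left_mono powr_mono') (auto simp: \<epsilon>_def)
    finally show ?thesis
      using pos by (simp add: field_simps)
  qed
  moreover have "0 < (2 powr \<epsilon>) ^ n" by simp
  ultimately show ?thesis using that s0 by blast
qed

section \<open>Decay under regularly varying growth of the resolvent\<close>

text \<open>
  At large \<open>\<bar>s\<bar>\<close> one of the \<open>n\<close> resolvents is spent on \<open>res s (res 0 x) = (res 0 x - res s x) / (\<i> s)\<close>, which
  gains the factor \<open>1 / \<bar>s\<bar>\<close>; then \<open>s\<close> is replaced by \<open>r\<close> through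
  \<open>regularly_varying_power_quotient_le\<close>. Small \<open>\<bar>s\<bar>\<close> only contribute a constant, and the same monotonicity
  bounds \<open>(r powr \<alpha> / l r) ^ n / r\<close> from below.
\<close>

lemma (in imaginary_resolvent_semigroup) norm_res_power_res_0_le:
  fixes n :: nat
  assumes l: "slowly_varying_on a l" and mono: "mono_on {a..} l" and \<alpha>: "0 < \<alpha>" and n: "1 \<le> \<alpha> / 2 * n"
    and growth: "\<And>s x. b \<le> \<bar>s\<bar> \<Longrightarrow> norm (res s x) \<le> c * (\<bar>s\<bar> powr \<alpha> / l \<bar>s\<bar>) * norm x"
  obtains C r0 where "0 < C" "0 < r0" "a \<le> r0"
    "\<And>r s x. r0 \<le> r \<Longrightarrow> \<bar>s\<bar> \<le> r \<Longrightarrow>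
       norm ((res s ^^ n) (res 0 x)) \<le> C * ((r powr \<alpha> / l r) ^ n / r) * norm x"
proof -
  obtain s1 C1 where s1: "a \<le> s1" "0 < s1" "0 < C1" and quot: "\<And>s r. s1 \<le> s \<Longrightarrow> s \<le> r \<Longrightarrow>
      (s powr \<alpha> / l s) ^ n / s \<le> C1 * ((r powr \<alpha> / l r) ^ n / r)"
    using regularly_varying_power_quotient_le[OF l mono \<alpha> n] by blast
  define r0 where "r0 = max s1 b"
  have r0: "0 < r0" "a \<le> r0" "s1 \<le> r0" "b \<le> r0" using s1 by (auto simp: r0_def)
  define M where "M = (\<lambda>s. s powr \<alpha> / l s)"
  have M_pos: "0 < M s" if "r0 \<le> s" for s
    using that r0 slowly_varying_on_pos[OF l, of s] by (simp add: M_def)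
  have quot_M: "M s ^ n / s \<le> C1 * (M r ^ n / r)" if "r0 \<le> s" "s \<le> r" for s r
    using quot that r0 by (simp add: M_def)
  define c' where "c' = max c 1"
  have growth': "norm (res s x) \<le> c' * M \<bar>s\<bar> * norm x" if "r0 \<le> \<bar>s\<bar>" for s x
  proof -
    have "norm (res s x) \<le> c * M \<bar>s\<bar> * norm x"
      using growth[of s x] that r0 by (simp add: M_def)
    also have "\<dots> \<le> c' * M \<bar>s\<bar> * norm x"
      using M_pos[OF that] by (intro mult_right_mono) (auto simp: c'_def)
    finally show ?thesis .
  qed
  obtain B where B: "\<And>s x. s \<in> {- r0..r0} \<Longrightarrow> norm (res s x) \<le> B * norm x"
  proof -
    have "- r0 \<le> r0" using r0 by simp
    from res_bounded_on_compact[OF this] show thesis using that by blast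
  qed
  define B' where "B' = max B 1"
  have B': "norm (res s x) \<le> B' * norm x" if "\<bar>s\<bar> \<le> r0" for s x
  proof -
    have "s \<in> {- r0..r0}" using that by (auto simp: abs_le_iff)
    then have "norm (res s x) \<le> B * norm x" by (rule B)
    also have "\<dots> \<le> B' * norm x" by (intro mult_right_mono) (auto simp: B'_def)
    finally show ?thesis .
  qed
  have pow: "norm ((res s ^^ k) y) \<le> q ^ k * norm y"
    if "0 \<le> q" "\<And>x. norm (res s x) \<le> q * norm x" for s k y q
  proof (induction k)
    case (Suc k)
    have "norm ((res s ^^ Suc k) y) \<le> q * norm ((res s ^^ k) y)" using that(2) by simp
    also have "\<dots> \<le> q * (q ^ k * norm y)" using Suc that(1) by (intro mult_left_mono)
    finally show ?case by (simp add: mult_ac)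
  qed simp
  have "n \<noteq> 0" using n by (cases "n = 0") auto
  then obtain k where k: "n = Suc k" by (cases n) auto
  define m0 where "m0 = (M r0 ^ n / r0) / C1"
  have m0: "0 < m0" using M_pos[of r0] r0 s1 by (simp add: m0_def)
  have m0_le: "m0 \<le> M r ^ n / r" if "r0 \<le> r" for r
    using divide_right_mono[OF quot_M[OF order_refl that], of C1] s1 by (simp add: m0_def)
  define C2 where "C2 = B' ^ n * B' / m0"
  \<comment> \<open>In \<open>C3\<close>, the number \<open>min 1 (m0 * r0)\<close> is a lower bound for \<open>M\<close> on \<open>{r0..}\<close>.\<close>
  define C3 where "C3 = c' ^ k * (B' / min 1 (m0 * r0) + c') * C1"
  have B'_pos: "0 < B'" and c'_pos: "0 < c'" by (auto simp: B'_def c'_def)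
  have C2: "0 < C2" using m0 B'_pos by (simp add: C2_def)
  have C3: "0 < C3" using m0 B'_pos c'_pos r0 s1 by (simp add: C3_def add_pos_pos)
  have "norm ((res s ^^ n) (res 0 x)) \<le> (C2 + C3) * (M r ^ n / r) * norm x"
    if r: "r0 \<le> r" and s: "\<bar>s\<bar> \<le> r" for r s x
  proof -
    have Mr: "0 < M r ^ n / r" using M_pos[OF r] r r0 by simp
    consider "\<bar>s\<bar> \<le> r0" | "r0 \<le> \<bar>s\<bar>" by linarith
    then have "norm ((res s ^^ n) (res 0 x)) \<le> C2 * (M r ^ n / r) * norm x \<or>
      norm ((res s ^^ n) (res 0 x)) \<le> C3 * (M r ^ n / r) * norm x"
    proof cases
      case 1
      have "norm ((res s ^^ n) (res 0 x)) \<le> B' ^ n * norm (res 0 x)"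
        by (intro pow B'[OF 1]) (use B'_pos in auto)
      also have "\<dots> \<le> B' ^ n * (B' * norm x)"
        using B'[of 0 x] r0 B'_pos by (intro mult_left_mono) auto
      also have "\<dots> = C2 * m0 * norm x"
        using m0 by (simp add: C2_def)
      also have "\<dots> \<le> C2 * (M r ^ n / r) * norm x"
        using m0_le[OF r] C2 by (intro mult_right_mono mult_left_mono) auto
      finally show ?thesis by blast
    next
      case 2
      let ?m = "M \<bar>s\<bar>"
      have m: "0 < ?m" using M_pos 2 by simp
      have m_ge: "min 1 (m0 * r0) \<le> ?m"
      proof (cases "1 \<le> ?m")
        case False
        have "m0 * r0 \<le> (?m ^ n / \<bar>s\<bar>) * \<bar>s\<bar>"
          using m0_le[OF 2] m0 m 2 r0 by (intro mult_mono) auto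
        also have "\<dots> = ?m ^ n" using 2 r0 by simp
        also have "\<dots> \<le> ?m" using m False k power_decreasing[of 1 n ?m] by simp
        finally show ?thesis by simp
      qed simp
      have min_pos: "0 < min 1 (m0 * r0)" using m0 r0 by simp
      have "norm (res s (res 0 x)) * \<bar>s\<bar> = norm (res 0 x - res s x)"
      proof -
        have "(\<i> * complex_of_real s) *\<^sub>C res s (res 0 x) = res 0 x - res s x"
          using resolvent_identity[of 0 x s] by (simp add: algebra_simps)
        then have "norm (res 0 x - res s x) = norm ((\<i> * complex_of_real s) *\<^sub>C res s (res 0 x))"
          by simp
        then show ?thesis by (simp add: norm_mult mult.commute)
      qed
      also have "\<dots> \<le> norm (res 0 x) + norm (res s x)" by (rule norm_triangle_ineq4)
      also have "\<dots> \<le> B' * norm x + c' * ?m * norm x"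
        using B'[of 0 x] growth'[OF 2] r0 by (intro add_mono) auto
      also have "\<dots> \<le> B' * (?m / min 1 (m0 * r0)) * norm x + c' * ?m * norm x"
        using m_ge min_pos B'_pos
        by (intro add_right_mono mult_right_mono) (auto simp: le_divide_eq)
      finally have "norm (res s (res 0 x)) * \<bar>s\<bar> \<le> (B' / min 1 (m0 * r0) + c') * ?m * norm x"
        by (simp add: algebra_simps)
      moreover have "0 < \<bar>s\<bar>" using 2 r0 by linarith
      ultimately have one: "norm (res s (res 0 x)) \<le> (B' / min 1 (m0 * r0) + c') * ?m * norm x / \<bar>s\<bar>"
        by (simp add: pos_le_divide_eq)
      have "(res s ^^ n) (res 0 x) = (res s ^^ k) (res s (res 0 x))"
        by (simp only: k funpow_Suc_right o_apply)
      then have "norm ((res s ^^ n) (res 0 x)) \<le> (c' * ?m) ^ k * norm (res s (res 0 x))"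
        using pow[OF _ growth'[OF 2]] m c'_pos by simp
      also have "\<dots> \<le> (c' * ?m) ^ k * ((B' / min 1 (m0 * r0) + c') * ?m * norm x / \<bar>s\<bar>)"
        using m c'_pos by (intro mult_left_mono one) auto
      also have "\<dots> = c' ^ k * (B' / min 1 (m0 * r0) + c') * (?m ^ n / \<bar>s\<bar>) * norm x"
        by (simp add: k power_mult_distrib mult_ac)
      also have "\<dots> \<le> c' ^ k * (B' / min 1 (m0 * r0) + c') * (C1 * (M r ^ n / r)) * norm x"
        using quot_M[OF 2 s] c'_pos B'_pos min_pos
        by (intro mult_right_mono mult_left_mono) (auto intro: add_nonneg_nonneg)
      finally have "norm ((res s ^^ n) (res 0 x)) \<le> C3 * (M r ^ n / r) * norm x"
        by (simp add: C3_def mult_ac)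
      then show ?thesis by blast
    qed
    moreover have "0 \<le> C2 * (M r ^ n / r) * norm x" "0 \<le> C3 * (M r ^ n / r) * norm x"
      by (intro mult_nonneg_nonneg less_imp_le[OF C2] less_imp_le[OF C3] less_imp_le[OF Mr] norm_ge_zero)+
    ultimately show ?thesis
      by (simp only: distrib_right) linarith
  qed
  then show ?thesis
    using that[of "C2 + C3" r0] C2 C3 r0 by (auto simp: M_def)
qed

text \<open>
  At the frequency \<open>r = (t * l (t powr (1 / \<alpha>))) powr (1 / \<alpha>)\<close> the resolvent has order \<open>t\<close>: since \<open>l\<close>
  is bounded below, \<open>r\<close> is at least a multiple of \<open>t powr (1 / \<alpha>)\<close>, so \<open>l r\<close> is at least about
  \<open>l (t powr (1 / \<alpha>)) = r powr \<alpha> / t\<close>.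
\<close>

lemma eventually_decay_frequency:
  assumes l: "slowly_varying_on a l" and mono: "mono_on {a..} l" and \<alpha>: "0 < \<alpha>"
  shows "\<forall>\<^sub>F t in at_top. let r = (t * l (t powr (1 / \<alpha>))) powr (1 / \<alpha>) in
    r0 \<le> r \<and> r powr \<alpha> / l r \<le> 2 * t"
proof -
  define b where "b = max a 1"
  define c where "c = l b powr (1 / \<alpha>)"
  have lb: "0 < l b" using slowly_varying_on_pos[OF l, of b] by (simp add: b_def)
  then have c: "0 < c" by (simp add: c_def)
  have root: "filterlim (\<lambda>t::real. t powr (1 / \<alpha>)) at_top at_top"
    unfolding filterlim_at_top
  proof (intro allI eventually_at_top_linorderI)
    fix Z t :: real
    assume t: "max Z 1 powr \<alpha> \<le> t"
    have "Z \<le> (max Z 1 powr \<alpha>) powr (1 / \<alpha>)"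
      using \<alpha> by (simp add: powr_powr)
    also have "\<dots> \<le> t powr (1 / \<alpha>)"
      using t \<alpha> by (intro powr_mono2) auto
    finally show "Z \<le> t powr (1 / \<alpha>)" .
  qed
  have "\<forall>\<^sub>F u in at_top. 1 / 2 < l (c * u) / l u"
    using order_tendstoD(1)[OF slowly_varying_on_tendsto[OF l c], of "1 / 2"] by simp
  then have "\<forall>\<^sub>F u in at_top. 1 / 2 < l (c * u) / l u \<and> b \<le> u \<and> max b r0 / c \<le> u"
    by (intro eventually_conj eventually_ge_at_top)
  from eventually_compose_filterlim[OF this root] eventually_gt_at_top[of "0::real"]
  show ?thesis
  proof eventually_elim
    case (elim t)
    define u where "u = t powr (1 / \<alpha>)"
    define r where "r = (t * l u) powr (1 / \<alpha>)"
    have u: "b \<le> u" "max b r0 \<le> c * u" "1 / 2 < l (c * u) / l u"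
      using elim c by (auto simp: u_def divide_le_eq mult.commute)
    have lu: "0 < l u" "l b \<le> l u"
      using slowly_varying_on_pos[OF l, of u] u mono by (auto simp: b_def intro: mono_onD)
    have "c * u \<le> l u powr (1 / \<alpha>) * u"
      unfolding c_def using lu lb \<alpha> u by (intro mult_right_mono powr_mono2) (auto simp: b_def)
    also have "\<dots> = r"
      unfolding r_def u_def using lu elim by (simp add: powr_mult u_def)
    finally have r: "c * u \<le> r" .
    have "l u / 2 < l (c * u)"
      using u(3) lu by (simp add: field_simps)
    also have "l (c * u) \<le> l r"
      using mono r u by (auto simp: b_def intro: mono_onD)
    finally have lr: "l u / 2 < l r" .
    have "r powr \<alpha> = t * l u"
      unfolding r_def using lu elim \<alpha> by (simp add: powr_powr)
    then have "r powr \<alpha> / l r \<le> 2 * t"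
      using lr lu elim by (simp add: divide_le_eq field_simps)
    then show ?case
      using r u by (simp add: Let_def r_def u_def)
  qed
qed

theorem theorem5p6:
  fixes T :: "real \<Rightarrow> 'a::complex_hilbert \<Rightarrow> 'a"
    and D :: "'a set"
    and A :: "'a \<Rightarrow> 'a"
    and \<alpha> a :: real
    and l :: "real \<Rightarrow> real"
  assumes "C0_semigroup T"
    and "bounded_semigroup T"
    and "is_generator T D (\<lambda>x. - A x)"
    and "op_spectrum D A \<inter> {z. Re z = 0} = {}"
    and "\<alpha> > 0"
    and "slowly_varying_on a l"
    and "mono_on {a..} l"
    and "(\<lambda>s::real. onorm (inv_into D (\<lambda>x. (\<i> * complex_of_real s) *\<^sub>C x + A x)))
           \<in> O[at_infinity](\<lambda>s. \<bar>s\<bar> powr \<alpha> / l \<bar>s\<bar>)"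
  shows "(\<lambda>t. onorm (\<lambda>x. T t (inv_into D A x)))
           \<in> O[at_top](\<lambda>t. (t * l (t powr (1 / \<alpha>))) powr (- 1 / \<alpha>))"
proof -
  note l = assms(6) and mono = assms(7)
  obtain K0 where K0: "\<And>t. 0 \<le> t \<Longrightarrow> onorm (T t) \<le> K0"
    using assms(2) by (auto simp: bounded_semigroup_def)
  have "norm (T t x) \<le> max 1 K0 * norm x" if "0 \<le> t" for t x
  proof -
    have "norm (T t x) \<le> onorm (T t) * norm x"
      using assms(1) that by (intro onorm) (auto simp: C0_semigroup_def bounded_clinear_def)
    also have "\<dots> \<le> max 1 K0 * norm x"
      using K0[OF that] by (intro mult_right_mono) auto
    finally show ?thesis .
  qed
  then interpret imaginary_resolvent_semigroup T D A "max 1 K0"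
    using assms by unfold_locales auto
  obtain c where c: "0 < c"
    "\<forall>\<^sub>F s in at_infinity. norm (onorm (res s)) \<le> c * norm (\<bar>s\<bar> powr \<alpha> / l \<bar>s\<bar>)"
    using landau_o.bigE[OF assms(8)] unfolding res_def by blast
  then obtain b0 where b0: "\<And>s. b0 \<le> \<bar>s\<bar> \<Longrightarrow> norm (onorm (res s)) \<le> c * norm (\<bar>s\<bar> powr \<alpha> / l \<bar>s\<bar>)"
    by (auto simp: eventually_at_infinity)
  have growth: "norm (res s x) \<le> c * (\<bar>s\<bar> powr \<alpha> / l \<bar>s\<bar>) * norm x" if "max b0 a \<le> \<bar>s\<bar>" for s x
  proof -
    have "norm (res s x) \<le> onorm (res s) * norm x"
      by (rule onorm[OF res_bounded_linear])
    also have "\<dots> \<le> c * (\<bar>s\<bar> powr \<alpha> / l \<bar>s\<bar>) * norm x"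
      using b0[of s] that slowly_varying_on_pos[OF l, of "\<bar>s\<bar>"] by (intro mult_right_mono) auto
    finally show ?thesis .
  qed
  \<comment> \<open>The least \<open>n\<close> with \<open>n * \<alpha> / 2 \<ge> 1\<close>; the other half of \<open>\<alpha>\<close> is spent on Potter's bound.\<close>
  define n where "n = nat \<lceil>2 / \<alpha>\<rceil>"
  have "2 / \<alpha> \<le> n" unfolding n_def by (rule real_nat_ceiling_ge)
  then have n: "1 \<le> \<alpha> / 2 * n"
    using \<open>\<alpha> > 0\<close> by (simp add: field_simps)
  then have n1: "1 \<le> n"
    by (cases n) auto
  obtain C1 r0 where C1: "0 < C1" "0 < r0" "a \<le> r0"
    and powers: "\<And>r s x. r0 \<le> r \<Longrightarrow> \<bar>s\<bar> \<le> r \<Longrightarrow>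
       norm ((res s ^^ n) (res 0 x)) \<le> C1 * ((r powr \<alpha> / l r) ^ n / r) * norm x"
    using norm_res_power_res_0_le[OF l mono \<open>\<alpha> > 0\<close> n growth] by blast
  obtain C where C: "0 < C" and decay: "\<And>t r G x. \<lbrakk>1 \<le> t; 0 < r; 4 * pi \<le> t * r; 0 \<le> G;
       \<And>s y. \<bar>s\<bar> \<le> r \<Longrightarrow> norm ((res s ^^ n) (res 0 y)) \<le> G * norm y\<rbrakk>
     \<Longrightarrow> norm (T t (res 0 x)) \<le> C * (1 / r + G / t ^ n) * norm x"
    using orbit_decay[OF n1] by blast
  have "\<forall>\<^sub>F t in at_top. norm (onorm (\<lambda>x. T t (res 0 x)))
      \<le> C * (1 + C1 * 2 ^ n) * norm ((t * l (t powr (1 / \<alpha>))) powr (- 1 / \<alpha>))"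
    using eventually_decay_frequency[OF l mono \<open>\<alpha> > 0\<close>, of "max r0 (4 * pi)"] eventually_ge_at_top[of "1::real"]
  proof eventually_elim
    case (elim t)
    define r where "r = (t * l (t powr (1 / \<alpha>))) powr (1 / \<alpha>)"
    have r: "r0 \<le> r" "4 * pi \<le> r" "r powr \<alpha> / l r \<le> 2 * t"
      using elim by (auto simp: r_def Let_def)
    have lr: "0 < l r" "0 < r" using slowly_varying_on_pos[OF l, of r] r C1 by auto
    define G where "G = C1 * ((r powr \<alpha> / l r) ^ n / r)"
    have G: "0 \<le> G" using C1 lr by (simp add: G_def)
    have "G \<le> C1 * ((2 * t) ^ n / r)"
      unfolding G_def using C1 lr r(3) by (intro mult_left_mono divide_right_mono power_mono) auto
    then have "G / t ^ n \<le> C1 * ((2 * t) ^ n / r) / t ^ n"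
      using elim by (intro divide_right_mono) auto
    also have "\<dots> = C1 * 2 ^ n / r"
      using elim by (simp add: power_mult_distrib)
    finally have Gt: "G / t ^ n \<le> C1 * 2 ^ n / r" .
    have "1 * (4 * pi) \<le> t * r" using elim r by (intro mult_mono) auto
    then have "norm (T t (res 0 x)) \<le> C * (1 / r + G / t ^ n) * norm x" for x
      using elim lr G powers[OF r(1)] by (intro decay) (auto simp: G_def)
    moreover have "C * (1 / r + G / t ^ n) * norm x \<le> C * (1 + C1 * 2 ^ n) * (1 / r) * norm x" for x :: 'a
    proof -
      have "1 / r + G / t ^ n \<le> (1 + C1 * 2 ^ n) * (1 / r)"
        using Gt by (simp add: add_divide_distrib)
      then have "C * (1 / r + G / t ^ n) \<le> C * ((1 + C1 * 2 ^ n) * (1 / r))"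
        using C by (intro mult_left_mono) auto
      then have "C * (1 / r + G / t ^ n) * norm x \<le> C * ((1 + C1 * 2 ^ n) * (1 / r)) * norm x"
        by (rule mult_right_mono) simp
      then show ?thesis by (simp only: mult.assoc)
    qed
    ultimately have "onorm (\<lambda>x. T t (res 0 x)) \<le> C * (1 + C1 * 2 ^ n) * (1 / r)"
      using C C1 lr by (intro onorm_bound) (auto intro: order_trans)
    moreover have "0 \<le> onorm (\<lambda>x. T t (res 0 x))"
      using elim by (intro onorm_pos_le bounded_linear_compose[OF T_bounded_linear res_bounded_linear]) auto
    moreover have "1 / r = (t * l (t powr (1 / \<alpha>))) powr (- 1 / \<alpha>)"
      by (simp add: r_def powr_minus_divide)
    ultimately show ?case by simp
  qed
  then show ?thesis
    unfolding res_0_eq by (rule bigoI)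
qed

end
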